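(* Let $(M=\mathfrak a\times\mathcal L,\omega,s)$ be an elementary solvable symplectic symmetric space and $o=(0,0)$. Then the function $\tilde u:M\times M\to\mathcal K$ defined by $$\tilde u((a,l),(a',l'))=\sinh(a')l-\sinh(a)l'$$ satisfies (locally, i.e. the last equality being understood where the midpoint $\frac x2$ is defined) $$\tilde u(x,y)=-\tilde u(y,x)=-\tilde u(x,s_x(y))=-\tilde u(x,s_{\frac x2}(y))\qquad\forall x,y\in M$$ and is $\exp(\mathcal K)$-invariant. In particular, for every choice of an element $\xi\in\mathcal K^\star$, the function $u=\xi\circ\tilde u$ is an $o$-admissible two-point function on $M$ provided the midpoint map is globally defined. The associated admissible three-point function $S(x,y,z)=u(s_{\frac x2}(y),s_{\frac x2}(z))$ has the form $$S((a_1,l_1),(a_2,l_2),(a_3,l_3))=\xi\big(\sinh(a_1-a_2)l_3+\sinh(a_2-a_3)l_1+\sinh(a_3-a_1)l_2\big).$$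
   Context: **Symplectic symmetric spaces.** A symplectic symmetric space is a triple $(M,\omega,s)$ with $(M,\omega)$ a smooth connected symplectic manifold and $s:M\times M\to M$ smooth such that, writing $s_x(y)=s(x,y)$: each $s_x$ (the symmetry at $x$) is an involutive symplectic diffeomorphism having $x$ as an isolated fixed point, and $s_xs_ys_x=s_{s_x(y)}$. Its automorphism group $\mathrm{Aut}(M,\omega,s)$ is the group of all symplectic diffeomorphisms $\varphi$ of $(M,\omega)$ such that $\varphi s_x=s_{\varphi(x)}\varphi$ for all $x\in M$. The transvection group $G$ is the subgroup of $\mathrm{Aut}(M,\omega,s)$ generated by $\{s_xs_y\,;\,x,y\in M\}$; it is a connected Lie group, transitive on $M$. Fix $o\in M$. Conjugation by $s_o$ induces an involution $\sigma$ of its Lie algebra $\mathfrak g$, with $\pm1$-eigenspaces $\mathfrak g=\mathcal K\oplus\mathcal P$, $\mathcal P\cong T_oM$; let $\Omega$ be the pull-back of $\omega_o$ to $\mathfrak g$. Then $[\mathcal P,\mathcal P]=\mathcal K$, $\mathcal K$ acts faithfully on $\mathcal P$, $\Omega$ is a Chevalley 2-cocycle, $i(\mathcal K)\Omega=0$ and $\Omega|_{\mathcal P\times\mathcal P}$ is nondegenerate (the transvection triple). **Exact triples.** An exact triple $(\mathfrak g,\sigma,\Omega)$ consists of a finite-dimensional real Lie algebra with involutive automorphism $\sigma$, $\mathfrak g=\mathcal K\oplus\mathcal P$ being the decomposition into the $+1$-eigenspace $\mathcal K$ and the $-1$-eigenspace $\mathcal P$ of $\sigma$, $[\mathcal P,\mathcal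 P]=\mathcal K$, and $\Omega=\delta\xi_0$ a Chevalley 2-coboundary ($\xi_0\in\mathfrak g^\star$) with $i(\mathcal K)\Omega=0$ and $\Omega|_{\mathcal P\times\mathcal P}$ symplectic. The exact triple associated to $(M,\omega,s)$ is its transvection triple if $\Omega$ is a coboundary, and otherwise the one-dimensional central extension $\mathfrak g\oplus\mathbb RE$ of the transvection algebra by the cocycle $\Omega$ (with $\sigma(E)=E$). **Elementary solvable spaces.** $(M,\omega,s)$ is elementary solvable if in its associated exact triple one has $\mathfrak g=\mathfrak b\rtimes_\rho\mathfrak a$ with $\mathfrak a$, $\mathfrak b$ Abelian, $\rho:\mathfrak a\to\mathrm{End}(\mathfrak b)$, and $\sigma$ preserves $\mathfrak g=\mathfrak b\oplus\mathfrak a$. Then $\mathfrak a\subset\mathcal P$, $\mathfrak b=\mathcal K\oplus\mathcal L$ with $\mathcal L\subset\mathcal P$, and $\mathfrak a,\mathcal L$ are Lagrangian subspaces of $\mathcal P$ in duality under $\Omega$. For $a\in\mathfrak a$ put $\sinh(a)=\frac12(e^{\rho(a)}-e^{-\rho(a)})$, $\cosh(a)=\frac12(e^{\rho(a)}+e^{-\rho(a)})$ in $\mathrm{End}(\mathfrak b)$; $\sinh(a)$ exchanges $\mathcal K$ and $\mathcal L$ (maps each into the other), $\cosh(a)$ preserves them. $M$ is simply connected and identified with $\mathcal P=\mathfrak a\times\mathcal L$ with the constant symplectic form $\Omega$, and $s_{(a,l)}(a',l')=(2a-a',2\cosh(a-a')l-l')$. The element $\exp(\kappa)$, $\kappa\in\mathcal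 K$, acts on $M$ by $(a,l)\mapsto(a,l-\sinh(a)\kappa)$. **Midpoint map and admissible functions.** A midpoint map is a smooth map $x\mapsto\frac x2$ with $s_{\frac x2}(o)=x$; here it is given locally by $\frac{(a,l)}2=\frac12(a,\cosh(\frac12a)^{-1}l)$. It is globally defined if it is defined and smooth on all of $M$. When it is globally defined, an $o$-admissible two-point function is a $\mathrm{Stab}(o)$-invariant smooth function $u:M\times M\to\mathbb R$ with $u(x,y)=-u(y,x)=-u(x,s_x(y))=-u(x,s_{\frac x2}(y))$ for all $x,y\in M$, where $\mathrm{Stab}(o)$ is the stabilizer of $o$ in the automorphism group $\mathrm{Aut}(M,\omega,s)$. A smooth function $S:M\times M\times M\to\mathbb R$ is admissible if: (i) $S(x,y,z)=S(z,x,y)=-S(y,x,z)$; (ii) $S(s_m(x),s_m(y),s_m(z))=S(x,y,z)$ for all $x,y,z,m\in M$; (iii) $S(x,y,z)=-S(x,s_x(y),z)$ for all $x,y,z\in M$.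
   Formalization: Stab(o) is taken in the group generated by the symmetries s_x, not in Aut(M,ω,s), where invariance can fail (swap of factors of a non-flat product N×N, ξ not swap-invariant); for Aut(M,ω,s), o-admissibility is stated only when u is assumed Stab(o)-invariant. *)

theory Defs
  imports "HOL-Analysis.Analysis"
begin

section \<open>Smooth maps\<close>

text \<open>
  \<open>Ck k U f\<close> is intended for open \<open>U\<close>. In finite dimension, \<open>f\<close> is of class \<open>k + 1\<close> on \<open>U\<close> iff it is
  differentiable and all its directional derivatives are of class \<open>k\<close>.
\<close>

primrec Ck :: "nat \<Rightarrow> 'a::euclidean_space set \<Rightarrow> ('a \<Rightarrow> 'b::real_normed_vector) \<Rightarrow> bool" where
  "Ck 0 U = (\<lambda>f. continuous_on U f)"
| "Ck (Suc k) U = (\<lambda>f. \<exists>f'. (\<forall>x\<in>U. (f has_derivative f' x) (at x)) \<and> (\<forall>v. Ck k U (\<lambda>x. f' x v)))"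

text \<open>
  A map on an arbitrary subset is smooth if it has local smooth extensions to the ambient space. Below
  the subsets are linear subspaces (and products of such), for which this is smoothness in the usual sense.
\<close>

definition smooth_map_on :: "'a::euclidean_space set \<Rightarrow> ('a \<Rightarrow> 'b::real_normed_vector) \<Rightarrow> bool" where
  "smooth_map_on S f \<longleftrightarrow>
     (\<forall>x\<in>S. \<exists>U F. open U \<and> x \<in> U \<and> (\<forall>k. Ck k U F) \<and> (\<forall>y\<in>U \<inter> S. F y = f y))"


section \<open>Symplectic symmetric spaces on a vector space\<close>

text \<open>
  The manifold is a linear subspace \<open>M\<close> of a Euclidean space; every tangent space is \<open>M\<close> itself.
  A 2-form is a function \<open>\<omega>\<close> with \<open>\<omega> x v w\<close> its value at the point \<open>x\<close> on the tangent vectors \<open>v\<close>, \<open>w\<close>.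
  Points, forms and maps are only ever evaluated on \<open>M\<close>.
\<close>

definition symplectic_form_on :: "'m::euclidean_space set \<Rightarrow> ('m \<Rightarrow> 'm \<Rightarrow> 'm \<Rightarrow> real) \<Rightarrow> bool" where
  "symplectic_form_on M \<omega> \<longleftrightarrow>
     (\<forall>x\<in>M. \<forall>u\<in>M. \<forall>v\<in>M. \<forall>w\<in>M. \<forall>c d.
        \<omega> x (c *\<^sub>R u + d *\<^sub>R v) w = c * \<omega> x u w + d * \<omega> x v w) \<and>
     (\<forall>x\<in>M. \<forall>v\<in>M. \<forall>w\<in>M. \<omega> x v w = - \<omega> x w v) \<and>
     (\<forall>x\<in>M. \<forall>v\<in>M. (\<forall>w\<in>M. \<omega> x v w = 0) \<longrightarrow> v = 0) \<and>
     (\<forall>v\<in>M. \<forall>w\<in>M. smooth_map_on M (\<lambda>x. \<omega> x v w)) \<and>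
     (\<forall>x\<in>M. \<forall>u\<in>M. \<forall>v\<in>M. \<forall>w\<in>M.
        deriv (\<lambda>t. \<omega> (x + t *\<^sub>R u) v w) 0 + deriv (\<lambda>t. \<omega> (x + t *\<^sub>R v) w u) 0
          + deriv (\<lambda>t. \<omega> (x + t *\<^sub>R w) u v) 0 = 0)"

definition symplectic_diffeo ::
  "'m::euclidean_space set \<Rightarrow> ('m \<Rightarrow> 'm \<Rightarrow> 'm \<Rightarrow> real) \<Rightarrow> ('m \<Rightarrow> 'm) \<Rightarrow> bool" where
  "symplectic_diffeo M \<omega> \<phi> \<longleftrightarrow>
     bij_betw \<phi> M M \<and> smooth_map_on M \<phi> \<and> smooth_map_on M (inv_into M \<phi>) \<and>
     (\<forall>x\<in>M. \<exists>D. (\<phi> has_derivative D) (at x within M) \<and>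
        (\<forall>v\<in>M. \<forall>w\<in>M. \<omega> (\<phi> x) (D v) (D w) = \<omega> x v w))"

definition symplectic_symmetric_space ::
  "'m::euclidean_space set \<Rightarrow> ('m \<Rightarrow> 'm \<Rightarrow> 'm \<Rightarrow> real) \<Rightarrow> ('m \<Rightarrow> 'm \<Rightarrow> 'm) \<Rightarrow> bool" where
  "symplectic_symmetric_space M \<omega> s \<longleftrightarrow>
     subspace M \<and> symplectic_form_on M \<omega> \<and>
     smooth_map_on (M \<times> M) (\<lambda>(x, y). s x y) \<and>
     (\<forall>x\<in>M. symplectic_diffeo M \<omega> (s x)) \<and>
     (\<forall>x\<in>M. \<forall>y\<in>M. s x (s x y) = y) \<and>
     (\<forall>x\<in>M. s x x = x \<and> (\<exists>U. open U \<and> x \<in> U \<and> (\<forall>y\<in>U \<inter> M. s x y = y \<longrightarrow> y = x))) \<and>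
     (\<forall>x\<in>M. \<forall>y\<in>M. \<forall>z\<in>M. s x (s y (s x z)) = s (s x y) z)"

definition automorphism_group ::
  "'m::euclidean_space set \<Rightarrow> ('m \<Rightarrow> 'm \<Rightarrow> 'm \<Rightarrow> real) \<Rightarrow> ('m \<Rightarrow> 'm \<Rightarrow> 'm) \<Rightarrow> ('m \<Rightarrow> 'm) set" where
  "automorphism_group M \<omega> s =
     {\<phi>. symplectic_diffeo M \<omega> \<phi> \<and> (\<forall>x\<in>M. \<forall>y\<in>M. \<phi> (s x y) = s (\<phi> x) (\<phi> y))}"

text \<open>
  The group of bijections of \<open>M\<close> generated by \<open>F\<close>. A bijection of \<open>M\<close> is represented by every
  HOL function with the right values on \<open>M\<close>, whence the rule \<open>same\<close>.
\<close>

inductive_set generated_group :: "'m set \<Rightarrow> ('m \<Rightarrow> 'm) set \<Rightarrow> ('m \<Rightarrow> 'm) set"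
  for M :: "'m set" and F :: "('m \<Rightarrow> 'm) set" where
  ident: "id \<in> generated_group M F"
| base: "f \<in> F \<Longrightarrow> f \<in> generated_group M F"
| comp: "f \<in> generated_group M F \<Longrightarrow> g \<in> generated_group M F \<Longrightarrow> f \<circ> g \<in> generated_group M F"
| inverse: "f \<in> generated_group M F \<Longrightarrow> inv_into M f \<in> generated_group M F"
| same: "f \<in> generated_group M F \<Longrightarrow> (\<And>x. x \<in> M \<Longrightarrow> g x = f x) \<Longrightarrow> g \<in> generated_group M F"

definition transvection_group :: "'m set \<Rightarrow> ('m \<Rightarrow> 'm \<Rightarrow> 'm) \<Rightarrow> ('m \<Rightarrow> 'm) set" where
  "transvection_group M s = generated_group M {s x \<circ> s y |x y. x \<in> M \<and> y \<in> M}"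

text \<open>It contains the transvection group, as a subgroup of index at most 2.\<close>

definition symmetry_group :: "'m set \<Rightarrow> ('m \<Rightarrow> 'm \<Rightarrow> 'm) \<Rightarrow> ('m \<Rightarrow> 'm) set" where
  "symmetry_group M s = generated_group M {s x |x. x \<in> M}"

definition stabilizer :: "('m \<Rightarrow> 'm) set \<Rightarrow> 'm \<Rightarrow> ('m \<Rightarrow> 'm) set" where
  "stabilizer H p = {\<phi> \<in> H. \<phi> p = p}"


section \<open>Triples\<close>

definition lie_algebra :: "('g::euclidean_space \<Rightarrow> 'g \<Rightarrow> 'g) \<Rightarrow> bool" where
  "lie_algebra br \<longleftrightarrow> bilinear br \<and> (\<forall>x. br x x = 0) \<and>
     (\<forall>x y z. br x (br y z) + br y (br z x) + br z (br x y) = 0)"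

definition coboundary :: "('g::euclidean_space \<Rightarrow> 'g \<Rightarrow> 'g) \<Rightarrow> ('g \<Rightarrow> 'g \<Rightarrow> real) \<Rightarrow> bool" where
  "coboundary br \<Omega> \<longleftrightarrow> (\<exists>\<xi>. linear \<xi> \<and> (\<forall>x y. \<Omega> x y = - \<xi> (br x y)))"

definition eigK :: "('g::euclidean_space \<Rightarrow> 'g) \<Rightarrow> 'g set" where
  "eigK \<sigma> = {x. \<sigma> x = x}"

definition eigP :: "('g::euclidean_space \<Rightarrow> 'g) \<Rightarrow> 'g set" where
  "eigP \<sigma> = {x. \<sigma> x = - x}"

definition exact_triple ::
  "('g::euclidean_space \<Rightarrow> 'g \<Rightarrow> 'g) \<Rightarrow> ('g \<Rightarrow> 'g) \<Rightarrow> ('g \<Rightarrow> 'g \<Rightarrow> real) \<Rightarrow> bool" where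
  "exact_triple br \<sigma> \<Omega> \<longleftrightarrow>
     lie_algebra br \<and>
     linear \<sigma> \<and> (\<forall>x. \<sigma> (\<sigma> x) = x) \<and> (\<forall>x y. \<sigma> (br x y) = br (\<sigma> x) (\<sigma> y)) \<and>
     span {br x y |x y. x \<in> eigP \<sigma> \<and> y \<in> eigP \<sigma>} = eigK \<sigma> \<and>
     coboundary br \<Omega> \<and>
     (\<forall>k\<in>eigK \<sigma>. \<forall>x. \<Omega> k x = 0) \<and>
     (\<forall>x\<in>eigP \<sigma>. (\<forall>y\<in>eigP \<sigma>. \<Omega> x y = 0) \<longrightarrow> x = 0)"

definition exp_end :: "('g::euclidean_space \<Rightarrow> 'g) \<Rightarrow> 'g \<Rightarrow> 'g" where
  "exp_end T x = (\<Sum>n. (1 / fact n) *\<^sub>R (T ^^ n) x)"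

text \<open>
  \<open>(br, \<sigma>, \<Omega>)\<close> is the transvection triple of \<open>(M, \<omega>, s)\<close> at \<open>p\<close>: the witness \<open>ex\<close> is the
  exponential map of the transvection group, viewed as an action on \<open>M\<close>. The sign of the bracket is that
  of the left action, \<open>ex X \<circ> ex Y \<circ> ex (- X) = ex (Ad (ex X) Y)\<close> with \<open>Ad (ex X)\<close> the exponential
  of \<open>ad X\<close>.
\<close>

definition transvection_triple_of ::
  "'m::euclidean_space set \<Rightarrow> ('m \<Rightarrow> 'm \<Rightarrow> 'm \<Rightarrow> real) \<Rightarrow> ('m \<Rightarrow> 'm \<Rightarrow> 'm) \<Rightarrow> 'm \<Rightarrow>
   ('h::euclidean_space \<Rightarrow> 'h \<Rightarrow> 'h) \<Rightarrow> ('h \<Rightarrow> 'h) \<Rightarrow> ('h \<Rightarrow> 'h \<Rightarrow> real) \<Rightarrow> bool" where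
  "transvection_triple_of M \<omega> s p br \<sigma> \<Omega> \<longleftrightarrow>
     lie_algebra br \<and>
     (\<exists>ex :: 'h \<Rightarrow> 'm \<Rightarrow> 'm.
        (\<forall>X. ex X \<in> transvection_group M s) \<and>
        (\<forall>\<phi>\<in>transvection_group M s. \<exists>Xs. \<forall>x\<in>M. \<phi> x = foldr ex Xs x) \<and>
        smooth_map_on (UNIV \<times> M) (\<lambda>(X, x). ex X x) \<and>
        (\<forall>X t r. \<forall>x\<in>M. ex ((t + r) *\<^sub>R X) x = ex (t *\<^sub>R X) (ex (r *\<^sub>R X) x)) \<and>
        (\<forall>X. (\<forall>t. \<forall>x\<in>M. ex (t *\<^sub>R X) x = x) \<longrightarrow> X = 0) \<and>
        (\<forall>X Y. \<forall>x\<in>M. ex X (ex Y (ex (- X) x)) = ex (exp_end (br X) Y) x) \<and>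
        (\<forall>X. \<forall>x\<in>M. s p (ex X (s p x)) = ex (\<sigma> X) x) \<and>
        (\<forall>X Y. \<exists>v w. ((\<lambda>t. ex (t *\<^sub>R X) p) has_vector_derivative v) (at 0) \<and>
           ((\<lambda>t. ex (t *\<^sub>R Y) p) has_vector_derivative w) (at 0) \<and> \<Omega> X Y = \<omega> p v w))"

text \<open>
  The triple \<open>(brh, \<sigma>h, \<Omega>h)\<close> itself, or its one-dimensional central extension by \<open>\<Omega>h\<close>,
  in both cases up to isomorphism.
\<close>

definition associated_exact_triple ::
  "('h::euclidean_space \<Rightarrow> 'h \<Rightarrow> 'h) \<Rightarrow> ('h \<Rightarrow> 'h) \<Rightarrow> ('h \<Rightarrow> 'h \<Rightarrow> real) \<Rightarrow>
   ('g::euclidean_space \<Rightarrow> 'g \<Rightarrow> 'g) \<Rightarrow> ('g \<Rightarrow> 'g) \<Rightarrow> ('g \<Rightarrow> 'g \<Rightarrow> real) \<Rightarrow> bool" where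
  "associated_exact_triple brh \<sigma>h \<Omega>h br \<sigma> \<Omega> \<longleftrightarrow>
     (if coboundary brh \<Omega>h then
        (\<exists>\<Phi> :: 'h \<Rightarrow> 'g. linear \<Phi> \<and> bij \<Phi> \<and>
           (\<forall>X Y. br (\<Phi> X) (\<Phi> Y) = \<Phi> (brh X Y)) \<and>
           (\<forall>X. \<sigma> (\<Phi> X) = \<Phi> (\<sigma>h X)) \<and>
           (\<forall>X Y. \<Omega> (\<Phi> X) (\<Phi> Y) = \<Omega>h X Y))
      else
        (\<exists>\<Phi> :: 'h \<times> real \<Rightarrow> 'g. linear \<Phi> \<and> bij \<Phi> \<and>
           (\<forall>X Y c d. br (\<Phi> (X, c)) (\<Phi> (Y, d)) = \<Phi> (brh X Y, \<Omega>h X Y)) \<and>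
           (\<forall>X c. \<sigma> (\<Phi> (X, c)) = \<Phi> (\<sigma>h X, c)) \<and>
           (\<forall>X Y c d. \<Omega> (\<Phi> (X, c)) (\<Phi> (Y, d)) = \<Omega>h X Y)))"


section \<open>Elementary solvable spaces\<close>

text \<open>
  \<open>\<rho> a\<close> is the restriction of \<open>br a\<close> to \<open>B\<close>; \<open>sinh_op br a\<close> and \<open>cosh_op br a\<close> are only applied to
  elements of \<open>B\<close>.
\<close>

definition semidirect_abelian ::
  "('g::euclidean_space \<Rightarrow> 'g \<Rightarrow> 'g) \<Rightarrow> ('g \<Rightarrow> 'g) \<Rightarrow> 'g set \<Rightarrow> 'g set \<Rightarrow> bool" where
  "semidirect_abelian br \<sigma> A B \<longleftrightarrow>
     subspace A \<and> subspace B \<and> A \<inter> B = {0} \<and> (\<forall>x. \<exists>a\<in>A. \<exists>b\<in>B. x = a + b) \<and>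
     (\<forall>a\<in>A. \<forall>a'\<in>A. br a a' = 0) \<and> (\<forall>b\<in>B. \<forall>b'\<in>B. br b b' = 0) \<and>
     (\<forall>a\<in>A. \<forall>b\<in>B. br a b \<in> B) \<and>
     \<sigma> ` A \<subseteq> A \<and> \<sigma> ` B \<subseteq> B"

definition sinh_op :: "('g::euclidean_space \<Rightarrow> 'g \<Rightarrow> 'g) \<Rightarrow> 'g \<Rightarrow> 'g \<Rightarrow> 'g" where
  "sinh_op br a x = (1/2) *\<^sub>R (exp_end (br a) x - exp_end (\<lambda>y. - br a y) x)"

definition cosh_op :: "('g::euclidean_space \<Rightarrow> 'g \<Rightarrow> 'g) \<Rightarrow> 'g \<Rightarrow> 'g \<Rightarrow> 'g" where
  "cosh_op br a x = (1/2) *\<^sub>R (exp_end (br a) x + exp_end (\<lambda>y. - br a y) x)"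

definition eigL :: "('g::euclidean_space \<Rightarrow> 'g) \<Rightarrow> 'g set \<Rightarrow> 'g set" where
  "eigL \<sigma> B = B \<inter> eigP \<sigma>"

text \<open>
  \<open>(M, \<omega>, s)\<close> with \<open>M = A \<times> L\<close> in the global coordinates \<open>(a, l)\<close>, in which \<open>\<omega>\<close> is
  the constant form \<open>\<Omega>\<close> under \<open>A \<times> L = A \<oplus> L = P\<close>.
\<close>

definition elementary_solvable_space ::
  "('h::euclidean_space \<Rightarrow> 'h \<Rightarrow> 'h) \<Rightarrow> ('h \<Rightarrow> 'h) \<Rightarrow> ('h \<Rightarrow> 'h \<Rightarrow> real) \<Rightarrow>
   ('g::euclidean_space \<Rightarrow> 'g \<Rightarrow> 'g) \<Rightarrow> ('g \<Rightarrow> 'g) \<Rightarrow> ('g \<Rightarrow> 'g \<Rightarrow> real) \<Rightarrow> 'g set \<Rightarrow> 'g set \<Rightarrow>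
   ('g \<times> 'g) set \<Rightarrow> ('g \<times> 'g \<Rightarrow> 'g \<times> 'g \<Rightarrow> 'g \<times> 'g \<Rightarrow> real) \<Rightarrow> ('g \<times> 'g \<Rightarrow> 'g \<times> 'g \<Rightarrow> 'g \<times> 'g) \<Rightarrow>
   bool" where
  "elementary_solvable_space brh \<sigma>h \<Omega>h br \<sigma> \<Omega> A B M \<omega> s \<longleftrightarrow>
     symplectic_symmetric_space M \<omega> s \<and>
     transvection_triple_of M \<omega> s (0, 0) brh \<sigma>h \<Omega>h \<and>
     associated_exact_triple brh \<sigma>h \<Omega>h br \<sigma> \<Omega> \<and>
     exact_triple br \<sigma> \<Omega> \<and>
     semidirect_abelian br \<sigma> A B \<and>
     M = A \<times> eigL \<sigma> B \<and>
     (\<forall>x\<in>M. \<forall>v\<in>M. \<forall>w\<in>M. \<omega> x v w = \<Omega> (fst v + snd v) (fst w + snd w)) \<and>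
     (\<forall>a l a' l'. (a, l) \<in> M \<longrightarrow> (a', l') \<in> M \<longrightarrow>
        s (a, l) (a', l') = (2 *\<^sub>R a - a', 2 *\<^sub>R cosh_op br (a - a') l - l'))"

definition exp_action :: "('g::euclidean_space \<Rightarrow> 'g \<Rightarrow> 'g) \<Rightarrow> 'g \<Rightarrow> 'g \<times> 'g \<Rightarrow> 'g \<times> 'g" where
  "exp_action br \<kappa> = (\<lambda>(a, l). (a, l - sinh_op br a \<kappa>))"


section \<open>Midpoints and admissible functions\<close>

definition midpoint_map :: "'m::euclidean_space set \<Rightarrow> ('m \<Rightarrow> 'm \<Rightarrow> 'm) \<Rightarrow> 'm \<Rightarrow> ('m \<Rightarrow> 'm) \<Rightarrow> bool" where
  "midpoint_map M s p h \<longleftrightarrow> smooth_map_on M h \<and> (\<forall>x\<in>M. h x \<in> M \<and> s (h x) p = x)"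

definition half_domain :: "('g::euclidean_space \<Rightarrow> 'g \<Rightarrow> 'g) \<Rightarrow> 'g set \<Rightarrow> 'g set \<Rightarrow> ('g \<times> 'g) set" where
  "half_domain br A L = {(a, l). a \<in> A \<and> l \<in> L \<and> bij_betw (cosh_op br ((1/2) *\<^sub>R a)) L L}"

definition half :: "('g::euclidean_space \<Rightarrow> 'g \<Rightarrow> 'g) \<Rightarrow> 'g set \<Rightarrow> 'g \<times> 'g \<Rightarrow> 'g \<times> 'g" where
  "half br L = (\<lambda>(a, l). (1/2) *\<^sub>R (a, inv_into L (cosh_op br ((1/2) *\<^sub>R a)) l))"

text \<open>
  The group \<open>H\<close> whose stabilizer \<open>Stab(p)\<close> is used is a parameter. The functions \<open>\<xi> \<circ> u_tilde br\<close>
  below need not be invariant under the stabilizer in the full automorphism group: exchanging the factors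
  of \<open>N \<times> N\<close>, \<open>N\<close> elementary solvable and not flat, acts non-trivially on the dual of \<open>K\<close>.
  They are invariant under the stabilizer in the group generated by the symmetries.
\<close>

definition o_admissible ::
  "('m \<Rightarrow> 'm) set \<Rightarrow> 'm::euclidean_space set \<Rightarrow> ('m \<Rightarrow> 'm \<Rightarrow> 'm) \<Rightarrow> 'm \<Rightarrow> ('m \<Rightarrow> 'm) \<Rightarrow>
   ('m \<Rightarrow> 'm \<Rightarrow> real) \<Rightarrow> bool" where
  "o_admissible H M s p h u \<longleftrightarrow>
     smooth_map_on (M \<times> M) (\<lambda>(x, y). u x y) \<and>
     (\<forall>\<phi>\<in>stabilizer H p. \<forall>x\<in>M. \<forall>y\<in>M. u (\<phi> x) (\<phi> y) = u x y) \<and>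
     (\<forall>x\<in>M. \<forall>y\<in>M. u x y = - u y x \<and> u x y = - u x (s x y) \<and> u x y = - u x (s (h x) y))"

definition admissible3 ::
  "'m::euclidean_space set \<Rightarrow> ('m \<Rightarrow> 'm \<Rightarrow> 'm) \<Rightarrow> ('m \<Rightarrow> 'm \<Rightarrow> 'm \<Rightarrow> real) \<Rightarrow> bool" where
  "admissible3 M s S \<longleftrightarrow>
     smooth_map_on (M \<times> M \<times> M) (\<lambda>(x, y, z). S x y z) \<and>
     (\<forall>x\<in>M. \<forall>y\<in>M. \<forall>z\<in>M. S x y z = S z x y \<and> S x y z = - S y x z) \<and>
     (\<forall>x\<in>M. \<forall>y\<in>M. \<forall>z\<in>M. \<forall>m\<in>M. S (s m x) (s m y) (s m z) = S x y z) \<and>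
     (\<forall>x\<in>M. \<forall>y\<in>M. \<forall>z\<in>M. S x y z = - S x (s x y) z)"

definition u_tilde :: "('g::euclidean_space \<Rightarrow> 'g \<Rightarrow> 'g) \<Rightarrow> 'g \<times> 'g \<Rightarrow> 'g \<times> 'g \<Rightarrow> 'g" where
  "u_tilde br = (\<lambda>(a, l) (a', l'). sinh_op br a' l - sinh_op br a l')"

definition three_point ::
  "('m \<Rightarrow> 'm \<Rightarrow> 'm) \<Rightarrow> ('m \<Rightarrow> 'm) \<Rightarrow> ('m \<Rightarrow> 'm \<Rightarrow> real) \<Rightarrow> 'm \<Rightarrow> 'm \<Rightarrow> 'm \<Rightarrow> real" where
  "three_point s h u x y z = u (s (h x) y) (s (h x) z)"

end

(*
  Put E(a) = exp(br a). Since A is Abelian, the operators br a with a in A commute, so E(a + c) = E(a) E(c) and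
  the operators sinh and cosh satisfy the usual product-to-sum formulas. All identities for u_tilde and for
  the three-point function follow from them; for x/2 one writes x = (2 h, cosh(h) n).
  An element of the group generated by the symmetries has the form
  (a, l) |-> (e a + c, e l + cosh(a) m + sinh(a) k) with e = 1 or e = -1. If it fixes (0, 0) then c = m = 0,
  and the terms sinh(a') sinh(a) k cancel in u_tilde.
*)

theory Submission
  imports Defs
begin

section \<open>Exponentials of endomorphisms\<close>

text \<open>Two obstacles shape the proof. Smoothness on a subspace asks for smooth extensions to
  the ambient space, but off \<open>A\<close> the operators \<open>br a\<close> need not commute and
  the addition law for E can fail; hence a linear projection onto \<open>A\<close> is inserted
  before exponentiating. Along \<open>A\<close> the addition law moves every base point to 0, so
  only the derivative of exp at 0 is required, and the maps z |-> E(alpha z)(beta z + w), with alpha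
  and beta linear, have directional derivatives of the same shape. The second obstacle is the
  stabilizer. The group is known through generators, so instead of identifying the isotropy group
  one shows that a normal form survives products and inverses, and evaluates it at the origin. The
  term sinh(a) k is the action of exp(K), except that k may be any element of the algebra; this is
  harmless because the cancellation uses only that sinh(a) and sinh(a') commute. That the operators
  \<open>br a\<close> commute on the whole algebra is the Jacobi identity. That the values lie in K
  follows from the involution being -1 on \<open>A\<close>, which in turn rests on [P, P] =
  K.\<close>

text \<open>
  Composition makes the bounded endomorphisms a Banach algebra. The type of bounded linear maps has two
  type parameters and cannot itself be an instance of the class, whence the copy.
\<close>

typedef (overloaded) 'a endo = "UNIV :: ('a::euclidean_space \<Rightarrow>\<^sub>L 'a) set"
  morphisms blinfun_of_endo endo_of_blinfun
  by simp

setup_lifting type_definition_endo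

instantiation endo :: (euclidean_space) real_normed_algebra_1
begin

lift_definition zero_endo :: "'a endo" is 0 .
lift_definition one_endo :: "'a endo" is id_blinfun .
lift_definition plus_endo :: "'a endo \<Rightarrow> 'a endo \<Rightarrow> 'a endo" is "(+)" .
lift_definition minus_endo :: "'a endo \<Rightarrow> 'a endo \<Rightarrow> 'a endo" is "(-)" .
lift_definition uminus_endo :: "'a endo \<Rightarrow> 'a endo" is uminus .
lift_definition times_endo :: "'a endo \<Rightarrow> 'a endo \<Rightarrow> 'a endo" is "(o\<^sub>L)" .
lift_definition scaleR_endo :: "real \<Rightarrow> 'a endo \<Rightarrow> 'a endo" is "(*\<^sub>R)" .
lift_definition norm_endo :: "'a endo \<Rightarrow> real" is norm .

definition dist_endo :: "'a endo \<Rightarrow> 'a endo \<Rightarrow> real" where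
  "dist_endo S T = norm (S - T)"
definition sgn_endo :: "'a endo \<Rightarrow> 'a endo" where
  "sgn_endo T = inverse (norm T) *\<^sub>R T"
definition uniformity_endo :: "('a endo \<times> 'a endo) filter" where
  "uniformity_endo = (INF e\<in>{0 <..}. principal {(x, y). dist x y < e})"
definition open_endo :: "'a endo set \<Rightarrow> bool" where
  "open_endo U \<longleftrightarrow> (\<forall>x\<in>U. \<forall>\<^sub>F (x', y) in uniformity. x' = x \<longrightarrow> y \<in> U)"

instance
proof
  fix S T U :: "'a endo" and c d :: real
  show "S + T + U = S + (T + U)" "S + T = T + S" "0 + S = S" "- S + S = 0" "S - T = S + - T"
    "c *\<^sub>R (S + T) = c *\<^sub>R S + c *\<^sub>R T" "(c + d) *\<^sub>R S = c *\<^sub>R S + d *\<^sub>R S"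
    "c *\<^sub>R d *\<^sub>R S = (c * d) *\<^sub>R S" "1 *\<^sub>R S = S"
    by (transfer; simp add: algebra_simps)+
  show "S * T * U = S * (T * U)" "(S + T) * U = S * U + T * U" "S * (T + U) = S * T + S * U"
    "1 * S = S" "S * 1 = S" "c *\<^sub>R S * T = c *\<^sub>R (S * T)" "S * c *\<^sub>R T = c *\<^sub>R (S * T)"
    by (transfer; auto intro!: blinfun_eqI simp: blinfun.bilinear_simps)+
  show "norm S = 0 \<longleftrightarrow> S = 0" "norm (S + T) \<le> norm S + norm T" "norm (c *\<^sub>R S) = \<bar>c\<bar> * norm S"
    "norm (1 :: 'a endo) = 1" "norm (S * T) \<le> norm S * norm T"
    by (transfer; simp add: norm_triangle_ineq norm_blinfun_compose)+
  show "dist S T = norm (S - T)" "sgn S = inverse (norm S) *\<^sub>R S"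
    "(uniformity :: ('a endo \<times> 'a endo) filter) = (INF e\<in>{0<..}. principal {(x, y). dist x y < e})"
    by (simp_all add: dist_endo_def sgn_endo_def uniformity_endo_def)
  show "open X = (\<forall>x\<in>X. \<forall>\<^sub>F (x', y) in uniformity. x' = x \<longrightarrow> y \<in> X)" for X :: "'a endo set"
    by (simp add: open_endo_def)
  show "(0 :: 'a endo) \<noteq> 1"
    by transfer (metis norm_blinfun_id norm_zero zero_neq_one)
qed

end

instance endo :: (euclidean_space) banach
proof
  fix X :: "nat \<Rightarrow> 'a endo"
  assume X: "Cauchy X"
  have dist: "dist (blinfun_of_endo S) (blinfun_of_endo T) = dist S T" for S T :: "'a endo"
    unfolding dist_norm by transfer simp
  have "Cauchy (\<lambda>n. blinfun_of_endo (X n))"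
    using X by (simp add: Cauchy_def dist)
  then obtain L where L: "(\<lambda>n. blinfun_of_endo (X n)) \<longlonglongrightarrow> L"
    using Cauchy_convergent_iff convergent_def by blast
  have "X \<longlonglongrightarrow> endo_of_blinfun L"
    using L by (simp add: lim_sequentially dist[symmetric] endo_of_blinfun_inverse)
  then show "convergent X"
    by (auto simp: convergent_def)
qed

section \<open>Evaluation of endomorphisms and the series \<open>exp_end\<close>\<close>

lift_definition endo_apply :: "'a::euclidean_space endo \<Rightarrow> 'a \<Rightarrow> 'a" is blinfun_apply .

lift_definition endo_of :: "('a::euclidean_space \<Rightarrow> 'a) \<Rightarrow> 'a endo" is Blinfun .

lemma endo_apply_endo_of: "linear T \<Longrightarrow> endo_apply (endo_of T) = T"
  by transfer (simp add: linear_conv_bounded_linear bounded_linear_Blinfun_apply)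

lemma endo_eqI: "(\<And>x. endo_apply S x = endo_apply T x) \<Longrightarrow> S = T"
  by transfer (rule blinfun_eqI)

lemma bounded_bilinear_endo_apply: "bounded_bilinear (endo_apply :: 'a::euclidean_space endo \<Rightarrow> _)"
proof
  show "\<exists>K. \<forall>(T::'a endo) x. norm (endo_apply T x) \<le> norm T * norm x * K"
    by (rule exI[of _ 1], transfer) (simp add: norm_blinfun)
qed (transfer; simp add: blinfun.bilinear_simps)+

interpretation endo_apply: bounded_bilinear endo_apply
  by (rule bounded_bilinear_endo_apply)

lemma endo_apply_one [simp]: "endo_apply 1 x = x"
  by transfer simp

lemma endo_apply_mult [simp]: "endo_apply (S * T) x = endo_apply S (endo_apply T x)"
  by transfer simp

lemma endo_apply_power: "endo_apply (T ^ n) x = (endo_apply T ^^ n) x"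
  by (induction n) simp_all

lemma
  assumes "linear T"
  shows exp_end_sums: "(\<lambda>n. (1 / fact n) *\<^sub>R (T ^^ n) x) sums exp_end T x"
    and exp_end_eq_exp: "exp_end T x = endo_apply (exp (endo_of T)) x"
proof -
  have "(\<lambda>n. endo_of T ^ n /\<^sub>R fact n) sums exp (endo_of T)"
    unfolding exp_def by (rule summable_sums[OF summable_exp_generic])
  then have "(\<lambda>n. endo_apply (endo_of T ^ n /\<^sub>R fact n) x) sums endo_apply (exp (endo_of T)) x"
    by (rule bounded_linear.sums[OF endo_apply.bounded_linear_left])
  then have *: "(\<lambda>n. (1 / fact n) *\<^sub>R (T ^^ n) x) sums endo_apply (exp (endo_of T)) x"
    by (simp add: endo_apply.scaleR_left endo_apply_power endo_apply_endo_of[OF assms] inverse_eq_divide)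
  show "exp_end T x = endo_apply (exp (endo_of T)) x"
    unfolding exp_end_def by (rule sums_unique[OF *, symmetric])
  then show "(\<lambda>n. (1 / fact n) *\<^sub>R (T ^^ n) x) sums exp_end T x"
    using * by simp
qed

text \<open>Intertwining passes to powers, and \<open>\<sigma>\<close>, continuous because the
  dimension is finite, passes through the series. The case of interest is the involution of the
  triple with the operators \<open>br a\<close> and \<open>br (- a)\<close>.\<close>

lemma exp_end_intertwine:
  assumes "linear T" "linear T'" "linear \<sigma>" "\<And>x. \<sigma> (T x) = T' (\<sigma> x)"
  shows "\<sigma> (exp_end T x) = exp_end T' (\<sigma> x)"
proof -
  have "\<sigma> ((T ^^ n) x) = (T' ^^ n) (\<sigma> x)" for n
    by (induction n) (simp_all add: assms(4))
  then have "(\<lambda>n. (1 / fact n) *\<^sub>R (T' ^^ n) (\<sigma> x)) sums \<sigma> (exp_end T x)"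
    using bounded_linear.sums[OF _ exp_end_sums[OF assms(1)], of \<sigma> x] assms(3)
    by (simp add: linear_scale[OF assms(3)] linear_conv_bounded_linear)
  then show ?thesis
    using exp_end_sums[OF assms(2)] sums_unique2 by blast
qed

lemma linear_exp_end:
  assumes "linear T"
  shows "linear (exp_end T)"
  using endo_apply.bounded_linear_right[THEN bounded_linear.linear]
  by (subst exp_end_eq_exp[OF assms, abs_def])

lemma exp_end_zero [simp]: "exp_end (\<lambda>x. 0) x = x"
proof -
  have "endo_of (\<lambda>x::'a. 0) = 0"
    by (rule endo_eqI) (simp add: endo_apply_endo_of linear_zero endo_apply.zero_left)
  then show ?thesis
    by (subst exp_end_eq_exp) (simp_all add: linear_zero)
qed

text \<open>This is what the Banach algebra is for: pointwise commutation becomes commutation of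
  \<open>endo_of S\<close> and \<open>endo_of T\<close>, where \<open>exp_add_commuting\<close>
  applies.\<close>

lemma exp_end_add_commuting:
  assumes "linear S" "linear T" "\<And>x. S (T x) = T (S x)"
  shows "exp_end (\<lambda>x. S x + T x) x = exp_end S (exp_end T x)"
proof -
  have lin: "linear (\<lambda>x. S x + T x)"
    using assms by (simp add: linear_compose_add)
  have "endo_of (\<lambda>x. S x + T x) = endo_of S + endo_of T"
    by (rule endo_eqI) (simp add: endo_apply_endo_of assms lin endo_apply.add_left)
  moreover have "endo_of S * endo_of T = endo_of T * endo_of S"
    by (rule endo_eqI) (simp add: endo_apply_endo_of assms)
  ultimately show ?thesis
    by (simp add: exp_end_eq_exp assms lin exp_add_commuting)
qed

section \<open>Derivative at 0 of the exponential in a Banach algebra\<close>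

lemma norm_exp_minus_first_two:
  fixes x :: "'a::{real_normed_algebra_1,banach}"
  shows "norm (exp x - 1 - x) \<le> (norm x)\<^sup>2 * exp (norm x)"
proof -
  define f where "f n = inverse (fact (n + 2)) *\<^sub>R x ^ (n + 2)" for n
  have le: "norm (f n) \<le> (norm x)\<^sup>2 * (norm x ^ n /\<^sub>R fact n)" for n
  proof -
    have "norm (f n) \<le> inverse (fact (n + 2)) * norm x ^ (n + 2)"
      unfolding f_def norm_scaleR by (intro mult_mono norm_power_ineq) simp_all
    \<comment> \<open>Weakening 1/(n+2)! to 1/n! turns the tail, after the square of the norm is
      taken out, into the exponential series of \<open>norm x\<close>.\<close>
    also have "\<dots> \<le> inverse (fact n) * norm x ^ (n + 2)"
      by (intro mult_right_mono le_imp_inverse_le fact_mono) (simp_all add: fact_mono)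
    finally show ?thesis
      by (simp add: power_add power2_eq_square mult_ac)
  qed
  have sums: "(\<lambda>n. (norm x)\<^sup>2 * (norm x ^ n /\<^sub>R fact n)) sums ((norm x)\<^sup>2 * exp (norm x))"
    unfolding exp_def by (intro sums_mult summable_sums summable_exp_generic)
  have "exp x - 1 - x = suminf f"
    unfolding f_def exp_first_two_terms by simp
  also have "norm \<dots> \<le> (norm x)\<^sup>2 * exp (norm x)"
    using norm_suminf_le[of f, OF le sums_summable[OF sums]] sums_unique[OF sums] by simp
  finally show ?thesis .
qed

text \<open>The remainder is quadratic. At a base point other than 0 the derivative is not simply
  multiplication by exp when the algebra is noncommutative; the addition law along \<open>A\<close>
  will reduce everything to this case.\<close>

lemma exp_has_derivative_0: "(exp has_derivative (\<lambda>h. h)) (at (0 :: 'a::{real_normed_algebra_1,banach}))"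
  unfolding has_derivative_at
proof
  have "((\<lambda>h::'a. norm h * exp (norm h)) \<longlongrightarrow> norm (0::'a) * exp (norm (0::'a))) (at 0)"
    by (intro tendsto_intros)
  then have lim: "((\<lambda>h::'a. norm h * exp (norm h)) \<longlongrightarrow> 0) (at 0)"
    by simp
  have "norm (norm (exp (0 + h) - exp 0 - h) / norm h) \<le> norm h * exp (norm h)" if "h \<noteq> 0" for h :: 'a
    using norm_exp_minus_first_two[of h] that by (simp add: field_simps power2_eq_square)
  then show "(\<lambda>h::'a. norm (exp (0 + h) - exp 0 - h) / norm h) \<midarrow>0\<rightarrow> 0"
    by (intro Lim_null_comparison[OF _ lim]) (simp add: eventually_at_filter)
qed simp

section \<open>Smooth maps\<close>

lemma Ck_subset: "Ck k U f \<Longrightarrow> V \<subseteq> U \<Longrightarrow> Ck k V f"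
proof (induction k arbitrary: f)
  case 0
  then show ?case
    using continuous_on_subset by auto
next
  case (Suc k)
  then show ?case
    by (simp; meson subsetD)
qed

lemma Ck_add:
  assumes "Ck k U f" "Ck k U g"
  shows "Ck k U (\<lambda>x. f x + g x)"
  using assms
proof (induction k arbitrary: f g)
  case 0
  then show ?case
    by (simp add: continuous_on_add)
next
  case (Suc k)
  obtain f' g' where f': "\<forall>x\<in>U. (f has_derivative f' x) (at x)" "\<And>v. Ck k U (\<lambda>x. f' x v)"
    and g': "\<forall>x\<in>U. (g has_derivative g' x) (at x)" "\<And>v. Ck k U (\<lambda>x. g' x v)"
    using Suc.prems by auto
  have "\<forall>x\<in>U. ((\<lambda>x. f x + g x) has_derivative (\<lambda>v. f' x v + g' x v)) (at x)"
    using f'(1) g'(1) by (auto intro: has_derivative_add)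
  then show ?case
    using Suc.IH[OF f'(2) g'(2)] by (auto intro!: exI[of _ "\<lambda>x v. f' x v + g' x v"])
qed

lemma smooth_map_on_cong:
  assumes "smooth_map_on S f" "\<And>x. x \<in> S \<Longrightarrow> g x = f x"
  shows "smooth_map_on S g"
  using assms unfolding smooth_map_on_def by (metis IntD2)

lemma smooth_map_on_add:
  assumes "smooth_map_on S f" "smooth_map_on S g"
  shows "smooth_map_on S (\<lambda>x. f x + g x)"
  unfolding smooth_map_on_def
proof
  fix x assume "x \<in> S"
  then obtain U F V G where "open U" "x \<in> U" "\<And>k. Ck k U F" "\<forall>y\<in>U \<inter> S. F y = f y"
    and "open V" "x \<in> V" "\<And>k. Ck k V G" "\<forall>y\<in>V \<inter> S. G y = g y"
    using assms unfolding smooth_map_on_def by metis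
  then show "\<exists>W H. open W \<and> x \<in> W \<and> (\<forall>k. Ck k W H) \<and> (\<forall>y\<in>W \<inter> S. H y = f y + g y)"
    by (intro exI[of _ "U \<inter> V"] exI[of _ "\<lambda>y. F y + G y"])
      (auto intro!: Ck_add intro: Ck_subset)
qed


section \<open>Hyperbolic functions of commuting derivations\<close>

text \<open>Isolates the one consequence of the Jacobi identity behind all hyperbolic identities;
  \<open>lie_algebra_commute\<close> supplies it for an Abelian \<open>A\<close>.\<close>

locale commuting_bracket =
  fixes br :: "'g::euclidean_space \<Rightarrow> 'g \<Rightarrow> 'g" and A :: "'g set"
  assumes bilinear_br: "bilinear br"
    and subspace_A: "subspace A"
    and br_commute: "a \<in> A \<Longrightarrow> c \<in> A \<Longrightarrow> br a (br c x) = br c (br a x)"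
begin

lemmas A_closed [simp, intro] =
  subspace_0[OF subspace_A] subspace_add[OF subspace_A] subspace_diff[OF subspace_A]
  subspace_neg[OF subspace_A] subspace_scale[OF subspace_A]

lemma linear_br: "linear (br a)"
  using bilinear_br unfolding bilinear_def by blast

lemma exp_br_zero [simp]: "exp_end (br 0) x = x"
  using ext[of "br 0" "\<lambda>x. 0", OF bilinear_lzero[OF bilinear_br]] by simp

lemma exp_br_add:
  assumes "a \<in> A" "c \<in> A"
  shows "exp_end (br (a + c)) x = exp_end (br a) (exp_end (br c) x)"
proof -
  have "br (a + c) = (\<lambda>x. br a x + br c x)"
    using bilinear_ladd[OF bilinear_br] by auto
  then show ?thesis
    using exp_end_add_commuting[OF linear_br linear_br br_commute[OF assms]] by simp
qed

lemma linear_exp_br: "linear (exp_end (br a))"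
  by (intro linear_exp_end linear_br)

text \<open>Bilinearity turns both exponentials into values of the single family E(a), to which the
  addition law applies.\<close>

lemma sinh_op_eq: "sinh_op br a x = (1/2) *\<^sub>R (exp_end (br a) x - exp_end (br (- a)) x)"
  and cosh_op_eq: "cosh_op br a x = (1/2) *\<^sub>R (exp_end (br a) x + exp_end (br (- a)) x)"
proof -
  have "br (- a) = (\<lambda>y. - br a y)"
    using bilinear_lneg[OF bilinear_br] by blast
  then show "sinh_op br a x = (1/2) *\<^sub>R (exp_end (br a) x - exp_end (br (- a)) x)"
    "cosh_op br a x = (1/2) *\<^sub>R (exp_end (br a) x + exp_end (br (- a)) x)"
    by (simp_all add: sinh_op_def cosh_op_def)
qed

lemma linear_sinh_op: "linear (sinh_op br a)"
  and linear_cosh_op: "linear (cosh_op br a)"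
  unfolding sinh_op_eq[abs_def] cosh_op_eq[abs_def]
  by (intro linear_compose_scale_right linear_compose_add linear_compose_sub linear_exp_br)+

lemmas sinh_op_linear_simps = linear_add[OF linear_sinh_op] linear_diff[OF linear_sinh_op]
  linear_neg[OF linear_sinh_op] linear_scale[OF linear_sinh_op] linear_0[OF linear_sinh_op]

lemmas cosh_op_linear_simps = linear_add[OF linear_cosh_op] linear_diff[OF linear_cosh_op]
  linear_neg[OF linear_cosh_op] linear_scale[OF linear_cosh_op] linear_0[OF linear_cosh_op]

lemma sinh_op_zero_left [simp]: "sinh_op br 0 x = 0"
  and cosh_op_zero_left [simp]: "cosh_op br 0 x = x"
  by (simp_all add: sinh_op_eq cosh_op_eq)

lemma sinh_op_minus_left: "sinh_op br (- a) x = - sinh_op br a x"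
  and cosh_op_minus_left: "cosh_op br (- a) x = cosh_op br a x"
  by (simp_all add: sinh_op_eq cosh_op_eq algebra_simps)

lemmas exp_br_linear_simps = linear_add[OF linear_exp_br] linear_diff[OF linear_exp_br]
  linear_scale[OF linear_exp_br]

context
  fixes a c
  assumes a: "a \<in> A" and c: "c \<in> A"
begin

text \<open>The last two results keep their arguments as negatives of those in the first two, so
  that they pair up as in \<open>sinh_op_eq\<close> and \<open>cosh_op_eq\<close>.\<close>

lemma exp_br_mult:
  "exp_end (br a) (exp_end (br c) x) = exp_end (br (a + c)) x"
  "exp_end (br a) (exp_end (br (- c)) x) = exp_end (br (a - c)) x"
  "exp_end (br (- a)) (exp_end (br c) x) = exp_end (br (- (a - c))) x"
  "exp_end (br (- a)) (exp_end (br (- c)) x) = exp_end (br (- (a + c))) x"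
  using a c by (simp_all add: exp_br_add[symmetric])

lemma sinh_cosh_op: "sinh_op br a (cosh_op br c x) = (1/2) *\<^sub>R (sinh_op br (a + c) x + sinh_op br (a - c) x)"
  unfolding sinh_op_eq cosh_op_eq exp_br_linear_simps exp_br_mult by (simp add: algebra_simps)

lemma cosh_sinh_op: "cosh_op br a (sinh_op br c x) = (1/2) *\<^sub>R (sinh_op br (a + c) x - sinh_op br (a - c) x)"
  unfolding sinh_op_eq cosh_op_eq exp_br_linear_simps exp_br_mult by (simp add: algebra_simps)

lemma sinh_sinh_op: "sinh_op br a (sinh_op br c x) = (1/2) *\<^sub>R (cosh_op br (a + c) x - cosh_op br (a - c) x)"
  unfolding sinh_op_eq cosh_op_eq exp_br_linear_simps exp_br_mult by (simp add: algebra_simps)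

lemma cosh_cosh_op: "cosh_op br a (cosh_op br c x) = (1/2) *\<^sub>R (cosh_op br (a + c) x + cosh_op br (a - c) x)"
  unfolding sinh_op_eq cosh_op_eq exp_br_linear_simps exp_br_mult by (simp add: algebra_simps)

text \<open>In the sum of two product formulas the terms in \<open>a - c\<close> cancel.\<close>

lemma sinh_op_add: "sinh_op br (a + c) x = sinh_op br a (cosh_op br c x) + cosh_op br a (sinh_op br c x)"
  and cosh_op_add: "cosh_op br (a + c) x = cosh_op br a (cosh_op br c x) + sinh_op br a (sinh_op br c x)"
  unfolding sinh_cosh_op cosh_sinh_op cosh_cosh_op sinh_sinh_op by (simp_all add: algebra_simps flip: scaleR_add_left)

end

text \<open>The product formula is symmetric in \<open>a\<close> and \<open>c\<close> because cosh
  is even. This gives the cancellation behind both invariance statements for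
  \<open>u_tilde\<close>.\<close>

lemma sinh_op_commute:
  assumes "a \<in> A" "c \<in> A"
  shows "sinh_op br a (sinh_op br c x) = sinh_op br c (sinh_op br a x)"
  using assms cosh_op_minus_left[of "a - c" x] by (simp add: sinh_sinh_op add.commute)

section \<open>Smoothness of exponentials along \<open>A\<close>\<close>

lemma exp_br_has_derivative:
  fixes \<alpha> \<beta> :: "'z::euclidean_space \<Rightarrow> 'g"
  assumes \<alpha>: "linear \<alpha>" "\<And>z. \<alpha> z \<in> A" and \<beta>: "linear \<beta>"
  shows "((\<lambda>z. exp_end (br (\<alpha> z)) (\<beta> z + w)) has_derivative
    (\<lambda>v. exp_end (br (\<alpha> z)) (br (\<alpha> v) (\<beta> z + w) + \<beta> v))) (at z)"
proof -
  define \<theta> where "\<theta> v = endo_of (br (\<alpha> v))" for v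
  have \<theta>_apply: "endo_apply (\<theta> v) = br (\<alpha> v)" for v
    unfolding \<theta>_def by (intro endo_apply_endo_of linear_br)
  have \<theta>_lin: "linear \<theta>"
    by (rule linearI; rule endo_eqI)
      (simp_all add: \<theta>_apply linear_add[OF \<alpha>(1)] linear_scale[OF \<alpha>(1)] bilinear_ladd[OF bilinear_br]
        bilinear_lmul[OF bilinear_br] endo_apply.add_left endo_apply.scaleR_left)
  have 1: "((\<lambda>v. exp (\<theta> (v - z))) has_derivative \<theta>) (at z)"
  proof -
    have "((\<lambda>v. \<theta> (v - z)) has_derivative \<theta>) (at z)"
      using \<theta>_lin by (auto intro!: derivative_eq_intros linear_imp_has_derivative
          has_derivative_compose[of "\<lambda>v. v - z", OF _ linear_imp_has_derivative[OF \<theta>_lin]])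
    from has_derivative_compose[OF this, of exp "\<lambda>h. h"] show ?thesis
      using exp_has_derivative_0 by (simp add: linear_0[OF \<theta>_lin])
  qed
  have 2: "((\<lambda>v. \<beta> v + w) has_derivative \<beta>) (at z)"
    by (auto intro!: derivative_eq_intros linear_imp_has_derivative \<beta>)
  \<comment> \<open>Product rule for evaluation. At v = z the exponential is the identity and its
    derivative is \<open>\<theta>\<close>, so no derivative of exp away from 0 appears.\<close>
  have "((\<lambda>v. endo_apply (exp (\<theta> (v - z))) (\<beta> v + w)) has_derivative
      (\<lambda>v. br (\<alpha> v) (\<beta> z + w) + \<beta> v)) (at z)"
    using endo_apply.FDERIV[OF 1 2]
    by (simp add: linear_0[OF \<theta>_lin] \<theta>_apply add.commute)
  then have "((\<lambda>v. exp_end (br (\<alpha> z)) (endo_apply (exp (\<theta> (v - z))) (\<beta> v + w))) has_derivative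
      (\<lambda>v. exp_end (br (\<alpha> z)) (br (\<alpha> v) (\<beta> z + w) + \<beta> v))) (at z)"
    by (rule has_derivative_compose) (rule linear_imp_has_derivative[OF linear_exp_br])
  \<comment> \<open>The addition law along \<open>A\<close> absorbs the fixed factor E(alpha z) and
    recovers the original map.\<close>
  moreover have "exp_end (br (\<alpha> z)) (endo_apply (exp (\<theta> (v - z))) x) = exp_end (br (\<alpha> v)) x" for v x
  proof -
    have "endo_apply (exp (\<theta> (v - z))) x = exp_end (br (\<alpha> (v - z))) x"
      unfolding \<theta>_def by (rule exp_end_eq_exp[symmetric]) (rule linear_br)
    moreover have "\<alpha> z + \<alpha> (v - z) = \<alpha> v"
      by (simp add: linear_diff[OF \<alpha>(1)])
    ultimately show ?thesis
      using exp_br_add[OF \<alpha>(2) \<alpha>(2), of z "v - z" x] by simp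
  qed
  ultimately show ?thesis
    by simp
qed

text \<open>Differentiating in direction v replaces \<open>\<beta>\<close> by its composition with
  \<open>br (\<alpha> v)\<close> and \<open>w\<close> by
  \<open>br (\<alpha> v) w + \<beta> v\<close>. The constant \<open>w\<close>, although 0 in the
  application, is what lets the induction close.\<close>

lemma Ck_exp_br:
  fixes \<alpha> \<beta> :: "'z::euclidean_space \<Rightarrow> 'g" and \<xi> :: "'g \<Rightarrow> 'b::real_normed_vector"
  assumes \<alpha>: "linear \<alpha>" "\<And>z. \<alpha> z \<in> A" and "linear \<beta>" and \<xi>: "linear \<xi>"
  shows "Ck k U (\<lambda>z. \<xi> (exp_end (br (\<alpha> z)) (\<beta> z + w)))"
  using \<open>linear \<beta>\<close>
proof (induction k arbitrary: \<beta> w)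
  case 0
  then show ?case
    by (auto intro!: continuous_at_imp_continuous_on has_derivative_continuous
      has_derivative_compose[OF exp_br_has_derivative[OF \<alpha>] linear_imp_has_derivative[OF \<xi>]])
next
  case (Suc k)
  have "((\<lambda>z. \<xi> (exp_end (br (\<alpha> z)) (\<beta> z + w))) has_derivative
      (\<lambda>v. \<xi> (exp_end (br (\<alpha> z)) (br (\<alpha> v) (\<beta> z + w) + \<beta> v)))) (at z)" for z
    by (rule has_derivative_compose[OF exp_br_has_derivative[OF \<alpha> Suc.prems] linear_imp_has_derivative[OF \<xi>]])
  moreover have "Ck k U (\<lambda>z. \<xi> (exp_end (br (\<alpha> z)) (br (\<alpha> v) (\<beta> z + w) + \<beta> v)))" for v
  proof -
    have "linear (\<lambda>z. br (\<alpha> v) (\<beta> z))"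
      using linear_compose[OF Suc.prems linear_br] by (simp add: o_def)
    from Suc.IH[OF this, of "br (\<alpha> v) w + \<beta> v"] show ?thesis
      by (simp add: linear_add[OF linear_br] add.assoc)
  qed
  ultimately show ?case
    by (auto intro!: exI[of _ "\<lambda>z v. \<xi> (exp_end (br (\<alpha> z)) (br (\<alpha> v) (\<beta> z + w) + \<beta> v))"])
qed

lemma smooth_map_on_sinh_op:
  fixes \<alpha> \<beta> :: "'z::euclidean_space \<Rightarrow> 'g" and \<xi> :: "'g \<Rightarrow> 'b::real_normed_vector"
  assumes "linear \<alpha>" "linear \<beta>" "linear \<xi>" "\<And>z. z \<in> S \<Longrightarrow> \<alpha> z \<in> A"
  shows "smooth_map_on S (\<lambda>z. \<xi> (sinh_op br (\<alpha> z) (\<beta> z)))"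
proof -
  \<comment> \<open>A left inverse of the identity on \<open>A\<close> is a linear projection onto
    \<open>A\<close>. With it the extension \<open>F\<close> exponentiates only elements of
    \<open>A\<close>, and it agrees with the given map on \<open>S\<close>.\<close>
  obtain \<pi> :: "'g \<Rightarrow> 'g" where \<pi>: "linear \<pi>" "\<And>x. \<pi> x \<in> A" "\<And>x. x \<in> A \<Longrightarrow> \<pi> x = x"
    using linear_exists_left_inverse_on[OF linear_id subspace_A] by (auto simp: image_subset_iff)
  define F where "F z = \<xi> ((1/2) *\<^sub>R exp_end (br (\<pi> (\<alpha> z))) (\<beta> z + 0))
    + \<xi> (- (1/2) *\<^sub>R exp_end (br (- \<pi> (\<alpha> z))) (\<beta> z + 0))" for z
  have \<alpha>': "linear (\<lambda>z. \<pi> (\<alpha> z))" "linear (\<lambda>z. - \<pi> (\<alpha> z))"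
    using linear_compose[OF assms(1) \<pi>(1)] by (simp_all add: o_def linear_compose_neg)
  have \<xi>': "linear (\<lambda>x. \<xi> (c *\<^sub>R x))" for c
    using linear_compose[OF linear_compose_scale_right[OF linear_id] assms(3)] by (simp add: o_def)
  have "Ck k UNIV F" for k
    unfolding F_def
    by (intro Ck_add Ck_exp_br[where \<xi> = "\<lambda>x. \<xi> (_ *\<^sub>R x)"] \<alpha>' \<xi>' assms(2)) (auto intro: \<pi>(2))
  moreover have "F z = \<xi> (sinh_op br (\<alpha> z) (\<beta> z))" if "z \<in> S" for z
    unfolding F_def sinh_op_eq using \<pi>(3)[OF assms(4)[OF that]]
    by (simp add: linear_add[OF assms(3), symmetric] algebra_simps)
  ultimately show ?thesis
    unfolding smooth_map_on_def by (intro ballI exI[of _ UNIV] exI[of _ F]) auto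
qed

end


section \<open>The two- and three-point functions\<close>

text \<open>The closed form of the three-point function before a functional is applied. All
  admissibility conditions are checked on it.\<close>

definition sinh_cyclic :: "('g::euclidean_space \<Rightarrow> 'g \<Rightarrow> 'g) \<Rightarrow> 'g \<times> 'g \<Rightarrow> 'g \<times> 'g \<Rightarrow> 'g \<times> 'g \<Rightarrow> 'g" where
  "sinh_cyclic br = (\<lambda>(a\<^sub>1, l\<^sub>1) (a\<^sub>2, l\<^sub>2) (a\<^sub>3, l\<^sub>3).
     sinh_op br (a\<^sub>1 - a\<^sub>2) l\<^sub>3 + sinh_op br (a\<^sub>2 - a\<^sub>3) l\<^sub>1 + sinh_op br (a\<^sub>3 - a\<^sub>1) l\<^sub>2)"

lemma sinh_cyclic_rotate: "sinh_cyclic br x y z = sinh_cyclic br z x y"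
  by (cases x; cases y; cases z) (simp add: sinh_cyclic_def)

lemma u_tilde_swap: "u_tilde br y x = - u_tilde br x y"
  by (cases x; cases y) (simp add: u_tilde_def)

context commuting_bracket
begin

lemma sinh_op_diff_swap: "sinh_op br (c - a) x = - sinh_op br (a - c) x"
  using sinh_op_minus_left[of "a - c"] by simp

lemma sinh_cyclic_swap: "sinh_cyclic br y x z = - sinh_cyclic br x y z"
proof -
  obtain a l b m c n where "x = (a, l)" "y = (b, m)" "z = (c, n)"
    by (metis surj_pair)
  then show ?thesis
    by (simp add: sinh_cyclic_def sinh_op_diff_swap[of b a] sinh_op_diff_swap[of a c] sinh_op_diff_swap[of c b])
qed

text \<open>Sum and difference are free parameters, so that each use can name them in the form in
  which terms later cancel.\<close>

lemma sinh_cosh_op_eq: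
  "a \<in> A \<Longrightarrow> c \<in> A \<Longrightarrow> a + c = p \<Longrightarrow> a - c = q \<Longrightarrow>
    sinh_op br a (cosh_op br c x) = (1/2) *\<^sub>R (sinh_op br p x + sinh_op br q x)"
  using sinh_cosh_op[of a c] by simp

text \<open>Twice sinh(a) cosh(a - c) is sinh(2a - c) + sinh(c): the first term cancels sinh(2a - c)
  l, the second leaves the reversed sign.\<close>

lemma u_tilde_symmetry:
  assumes "a \<in> A" "c \<in> A"
  shows "u_tilde br (a, l) (2 *\<^sub>R a - c, 2 *\<^sub>R cosh_op br (a - c) l - m) = - u_tilde br (a, l) (c, m)"
proof -
  have "sinh_op br a (cosh_op br (a - c) l) = (1/2) *\<^sub>R (sinh_op br (2 *\<^sub>R a - c) l + sinh_op br c l)"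
    using assms by (intro sinh_cosh_op_eq) (auto simp: scaleR_2)
  then show ?thesis
    by (simp add: u_tilde_def sinh_op_linear_simps)
qed

text \<open>Both products of sinh and cosh contain sinh(3h - c) n, which cancels. The rest is
  -sinh(c) cosh(h) n, as the third product shows.\<close>

lemma u_tilde_half_symmetry:
  assumes "h \<in> A" "c \<in> A"
  shows "u_tilde br (h + h, cosh_op br h n) (h + h - c, cosh_op br (h - c) n - m)
    = - u_tilde br (h + h, cosh_op br h n) (c, m)"
proof -
  have "sinh_op br (h + h) (cosh_op br (h - c) n) = (1/2) *\<^sub>R (sinh_op br (h + h + h - c) n + sinh_op br (h + c) n)"
    using assms by (intro sinh_cosh_op_eq) auto
  moreover have "sinh_op br (h + h - c) (cosh_op br h n) = (1/2) *\<^sub>R (sinh_op br (h + h + h - c) n + sinh_op br (h - c) n)"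
    using assms by (intro sinh_cosh_op_eq) auto
  \<comment> \<open>The difference c - h is written \<open>- (h - c)\<close> to meet the term of the
    preceding product.\<close>
  moreover have "sinh_op br c (cosh_op br h n) = (1/2) *\<^sub>R (sinh_op br (h + c) n + sinh_op br (- (h - c)) n)"
    using assms by (intro sinh_cosh_op_eq) auto
  ultimately show ?thesis
    unfolding u_tilde_def prod.case sinh_op_minus_left
    by (simp only: sinh_op_linear_simps) (simp add: scaleR_right_distrib scaleR_right_diff_distrib)
qed

text \<open>The terms sinh(3h - c - d) n cancel, and half the difference of sinh(h + c - d) n and
  sinh(h - c + d) n is sinh(c - d) cosh(h) n. Thus n enters only through cosh(h) n, and the midpoint
  disappears from the result.\<close>

lemma u_tilde_half_half:
  assumes "h \<in> A" "c \<in> A" "d \<in> A"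
  shows "u_tilde br (h + h - c, cosh_op br (h - c) n - l) (h + h - d, cosh_op br (h - d) n - m)
    = sinh_cyclic br (h + h, cosh_op br h n) (c, l) (d, m)"
proof -
  have "sinh_op br (h + h - d) (cosh_op br (h - c) n)
    = (1/2) *\<^sub>R (sinh_op br (h + h + h - c - d) n + sinh_op br (h + c - d) n)"
    using assms by (intro sinh_cosh_op_eq) auto
  moreover have "sinh_op br (h + h - c) (cosh_op br (h - d) n)
    = (1/2) *\<^sub>R (sinh_op br (h + h + h - c - d) n + sinh_op br (h - c + d) n)"
    using assms by (intro sinh_cosh_op_eq) auto
  moreover have "sinh_op br (c - d) (cosh_op br h n)
    = (1/2) *\<^sub>R (sinh_op br (h + c - d) n + sinh_op br (- (h - c + d)) n)"
    using assms by (intro sinh_cosh_op_eq) auto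
  ultimately show ?thesis
    unfolding u_tilde_def sinh_cyclic_def prod.case sinh_op_minus_left sinh_op_diff_swap[of d "h + h"]
    by (simp only: sinh_op_linear_simps) (simp add: scaleR_right_distrib scaleR_right_diff_distrib)
qed

text \<open>Twice sinh(d - a) cosh(a - c) is -sinh(c - d) - sinh(2a - c - d); the second term
  cancels the coefficient of l coming from the reflected point.\<close>

lemma sinh_cyclic_symmetry:
  assumes "a \<in> A" "c \<in> A" "d \<in> A"
  shows "sinh_cyclic br (a, l) (2 *\<^sub>R a - c, 2 *\<^sub>R cosh_op br (a - c) l - m) (d, n)
    = - sinh_cyclic br (a, l) (c, m) (d, n)"
proof -
  have *: "a - (2 *\<^sub>R a - c) = - (a - c)"
    by (simp add: scaleR_2)
  have "sinh_op br (d - a) (cosh_op br (a - c) l)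
    = (1/2) *\<^sub>R (sinh_op br (- (c - d)) l + sinh_op br (- (2 *\<^sub>R a - c - d)) l)"
    using assms by (intro sinh_cosh_op_eq) (auto simp: scaleR_2)
  then show ?thesis
    unfolding sinh_cyclic_def prod.case * sinh_op_minus_left
    by (simp only: sinh_op_linear_simps) (simp add: scaleR_right_distrib scaleR_right_diff_distrib)
qed

text \<open>A symmetry negates the differences of the first coordinates, so the \<open>m\<close>
  terms keep their sign and only the cyclic sum of sinh(c1 - c2) cosh(a - c3) l has to
  vanish.\<close>

lemma sinh_cyclic_invariant:
  assumes "a \<in> A" "c\<^sub>1 \<in> A" "c\<^sub>2 \<in> A" "c\<^sub>3 \<in> A"
  shows "sinh_cyclic br (2 *\<^sub>R a - c\<^sub>1, 2 *\<^sub>R cosh_op br (a - c\<^sub>1) l - m\<^sub>1)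
    (2 *\<^sub>R a - c\<^sub>2, 2 *\<^sub>R cosh_op br (a - c\<^sub>2) l - m\<^sub>2) (2 *\<^sub>R a - c\<^sub>3, 2 *\<^sub>R cosh_op br (a - c\<^sub>3) l - m\<^sub>3)
    = sinh_cyclic br (c\<^sub>1, m\<^sub>1) (c\<^sub>2, m\<^sub>2) (c\<^sub>3, m\<^sub>3)"
proof -
  have eqs: "2 *\<^sub>R a - c - (2 *\<^sub>R a - d) = - (c - d)" for c d
    by simp
  define d where "d c = a - c" for c
  have d: "d c \<in> A" if "c \<in> A" for c
    using assms(1) that by (simp add: d_def)
  have diff: "c\<^sub>1 - c\<^sub>2 = d c\<^sub>2 - d c\<^sub>1" "c\<^sub>2 - c\<^sub>3 = d c\<^sub>3 - d c\<^sub>2" "c\<^sub>3 - c\<^sub>1 = d c\<^sub>1 - d c\<^sub>3"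
    by (simp_all add: d_def)
  have product: "sinh_op br (d c' - d c) (cosh_op br (d e) l) =
    (1/2) *\<^sub>R (sinh_op br (d c' + d e - d c) l - sinh_op br (d c + d e - d c') l)"
    if "c \<in> A" "c' \<in> A" "e \<in> A" for c c' e
    using sinh_cosh_op[of "d c' - d c" "d e" l] sinh_op_minus_left[of "d c + d e - d c'" l] d that
    by (simp add: algebra_simps)
  \<comment> \<open>Let di = a - ci and let Ti be sinh(d1 + d2 + d3 - 2 di) l. The three summands
    are half of T1 - T2, T2 - T3 and T3 - T1, so the sum telescopes.\<close>
  have "sinh_op br (c\<^sub>1 - c\<^sub>2) (cosh_op br (a - c\<^sub>3) l) + sinh_op br (c\<^sub>2 - c\<^sub>3) (cosh_op br (a - c\<^sub>1) l)
     + sinh_op br (c\<^sub>3 - c\<^sub>1) (cosh_op br (a - c\<^sub>2) l) = 0"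
    unfolding diff d_def[symmetric] using assms(2-4) by (simp add: product add.commute flip: scaleR_add_right)
  then have "2 *\<^sub>R (sinh_op br (c\<^sub>1 - c\<^sub>2) (cosh_op br (a - c\<^sub>3) l) + sinh_op br (c\<^sub>2 - c\<^sub>3) (cosh_op br (a - c\<^sub>1) l)
     + sinh_op br (c\<^sub>3 - c\<^sub>1) (cosh_op br (a - c\<^sub>2) l)) = 0"
    by simp
  then show ?thesis
    unfolding sinh_cyclic_def prod.case eqs sinh_op_minus_left
    by (simp add: sinh_op_linear_simps algebra_simps)
qed

text \<open>The sign is -1 for a symmetry and multiplies under composition. Leaving \<open>m\<close>
  and \<open>k\<close> in the whole algebra spares tracking how sinh and cosh move between K and
  L.\<close>

definition affine_form :: "('g \<times> 'g) set \<Rightarrow> ('g \<times> 'g \<Rightarrow> 'g \<times> 'g) \<Rightarrow> bool" where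
  "affine_form M \<phi> \<longleftrightarrow> (\<exists>\<epsilon> c m k. (\<epsilon> = 1 \<or> \<epsilon> = - 1) \<and> c \<in> A \<and>
     (\<forall>(a, l)\<in>M. \<phi> (a, l) = (\<epsilon> *\<^sub>R a + c, \<epsilon> *\<^sub>R l + cosh_op br a m + sinh_op br a k)))"

lemma affine_formI:
  assumes "\<epsilon> = 1 \<or> \<epsilon> = - 1" "c \<in> A"
    and "\<And>a l. (a, l) \<in> M \<Longrightarrow> \<phi> (a, l) = (\<epsilon> *\<^sub>R a + c, \<epsilon> *\<^sub>R l + cosh_op br a m + sinh_op br a k)"
  shows "affine_form M \<phi>"
  using assms unfolding affine_form_def by (intro exI[of _ \<epsilon>] exI[of _ c] exI[of _ m] exI[of _ k]) auto

lemma affine_form_cong: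
  assumes "affine_form M \<phi>" "\<And>x. x \<in> M \<Longrightarrow> \<psi> x = \<phi> x"
  shows "affine_form M \<psi>"
proof -
  obtain \<epsilon> c m k where "\<epsilon> = 1 \<or> \<epsilon> = - 1" "c \<in> A"
    and "\<And>a l. (a, l) \<in> M \<Longrightarrow> \<phi> (a, l) = (\<epsilon> *\<^sub>R a + c, \<epsilon> *\<^sub>R l + cosh_op br a m + sinh_op br a k)"
    using assms(1) unfolding affine_form_def by fast
  then show ?thesis
    using assms(2) by (intro affine_formI[of \<epsilon> c M \<psi> m k]) simp_all
qed

lemma sinh_op_sign: "\<epsilon> = 1 \<or> \<epsilon> = - 1 \<Longrightarrow> sinh_op br (\<epsilon> *\<^sub>R a) x = \<epsilon> *\<^sub>R sinh_op br a x"
  and cosh_op_sign: "\<epsilon> = 1 \<or> \<epsilon> = - 1 \<Longrightarrow> cosh_op br (\<epsilon> *\<^sub>R a) x = cosh_op br a x"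
  by (auto simp: sinh_op_minus_left cosh_op_minus_left)

lemma affine_form_comp:
  assumes M: "M \<subseteq> A \<times> UNIV" "\<psi> ` M \<subseteq> M" and \<phi>: "affine_form M \<phi>" and \<psi>: "affine_form M \<psi>"
  shows "affine_form M (\<phi> \<circ> \<psi>)"
proof -
  obtain \<epsilon> c m k where \<epsilon>: "\<epsilon> = 1 \<or> \<epsilon> = - 1" and c: "c \<in> A"
    and \<phi>: "\<And>a l. (a, l) \<in> M \<Longrightarrow> \<phi> (a, l) = (\<epsilon> *\<^sub>R a + c, \<epsilon> *\<^sub>R l + cosh_op br a m + sinh_op br a k)"
    using \<phi> unfolding affine_form_def by fast
  obtain \<delta> d n j where \<delta>: "\<delta> = 1 \<or> \<delta> = - 1" and d: "d \<in> A"
    and \<psi>: "\<And>a l. (a, l) \<in> M \<Longrightarrow> \<psi> (a, l) = (\<delta> *\<^sub>R a + d, \<delta> *\<^sub>R l + cosh_op br a n + sinh_op br a j)"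
    using \<psi> unfolding affine_form_def by fast
  \<comment> \<open>The coefficients come from expanding cosh(delta a + d) m and sinh(delta a + d) k
    by the addition theorems and collecting the factors cosh(a) and sinh(a).\<close>
  have *: "(\<phi> \<circ> \<psi>) (a, l) = ((\<epsilon> * \<delta>) *\<^sub>R a + (\<epsilon> *\<^sub>R d + c), (\<epsilon> * \<delta>) *\<^sub>R l
      + cosh_op br a (\<epsilon> *\<^sub>R n + cosh_op br d m + sinh_op br d k)
      + sinh_op br a (\<epsilon> *\<^sub>R j + \<delta> *\<^sub>R sinh_op br d m + \<delta> *\<^sub>R cosh_op br d k))"
    if al: "(a, l) \<in> M" for a l
  proof -
    have a: "a \<in> A" "\<delta> *\<^sub>R a \<in> A"
      using al M(1) by auto
    have "(\<delta> *\<^sub>R a + d, \<delta> *\<^sub>R l + cosh_op br a n + sinh_op br a j) \<in> M"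
      using M(2) al \<psi>[OF al] by force
    from \<phi>[OF this] show ?thesis
      unfolding sinh_op_add[OF a(2) d] cosh_op_add[OF a(2) d] sinh_op_sign[OF \<delta>] cosh_op_sign[OF \<delta>]
      by (simp add: \<psi>[OF al] sinh_op_linear_simps cosh_op_linear_simps algebra_simps)
  qed
  have "\<epsilon> * \<delta> = 1 \<or> \<epsilon> * \<delta> = - 1" "\<epsilon> *\<^sub>R d + c \<in> A"
    using \<epsilon> \<delta> c d by auto
  then show ?thesis
    by (rule affine_formI[OF _ _ *])
qed

lemma affine_form_inverse:
  assumes M: "M \<subseteq> A \<times> UNIV" and bij: "bij_betw \<phi> M M" and \<phi>: "affine_form M \<phi>"
  shows "affine_form M (inv_into M \<phi>)"
proof -
  obtain \<epsilon> c m k where \<epsilon>: "\<epsilon> = 1 \<or> \<epsilon> = - 1" and c: "c \<in> A"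
    and \<phi>: "\<And>a l. (a, l) \<in> M \<Longrightarrow> \<phi> (a, l) = (\<epsilon> *\<^sub>R a + c, \<epsilon> *\<^sub>R l + cosh_op br a m + sinh_op br a k)"
    using \<phi> unfolding affine_form_def by fast
  \<comment> \<open>Solving a = epsilon a' + c with epsilon^2 = 1 gives a' = epsilon a + d. Solving
    for l' and expanding at this a' gives the two coefficients below.\<close>
  define d where "d = - \<epsilon> *\<^sub>R c"
  have d: "d \<in> A"
    using c unfolding d_def by blast
  have \<epsilon>\<epsilon>: "\<epsilon> * \<epsilon> = 1"
    using \<epsilon> by auto
  have "inv_into M \<phi> (a, l) = (\<epsilon> *\<^sub>R a + d, \<epsilon> *\<^sub>R l
      + cosh_op br a (- \<epsilon> *\<^sub>R (cosh_op br d m + sinh_op br d k))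
      + sinh_op br a (- (sinh_op br d m + cosh_op br d k)))"
    if al: "(a, l) \<in> M" for a l
  proof -
    obtain a' l' where inv: "inv_into M \<phi> (a, l) = (a', l')"
      by fastforce
    have "(a', l') \<in> M" "\<phi> (a', l') = (a, l)"
      using bij_betw_inv_into_right[OF bij al] bij_betwE[OF bij_betw_inv_into[OF bij]] al inv by auto
    then have eq: "a = \<epsilon> *\<^sub>R a' + c" "l = \<epsilon> *\<^sub>R l' + cosh_op br a' m + sinh_op br a' k"
      using \<phi> by auto
    have a': "a' = \<epsilon> *\<^sub>R a + d"
      using \<epsilon>\<epsilon> unfolding d_def eq(1) by (simp add: scaleR_right_distrib)
    have l': "l' = \<epsilon> *\<^sub>R (l - cosh_op br a' m - sinh_op br a' k)"
      using \<epsilon>\<epsilon> unfolding eq(2) by simp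
    have a: "\<epsilon> *\<^sub>R a \<in> A"
      using al M by auto
    show ?thesis
      unfolding inv l'
      unfolding a' sinh_op_add[OF a d] cosh_op_add[OF a d] sinh_op_sign[OF \<epsilon>] cosh_op_sign[OF \<epsilon>]
      using \<epsilon>\<epsilon> by (simp add: sinh_op_linear_simps cosh_op_linear_simps algebra_simps)
  qed
  then show ?thesis
    by (rule affine_formI[OF \<epsilon> d])
qed

lemma u_tilde_affine_form_invariant:
  assumes "M \<subseteq> A \<times> UNIV" "affine_form M \<phi>" "(0, 0) \<in> M" "\<phi> (0, 0) = (0, 0)" "x \<in> M" "y \<in> M"
  shows "u_tilde br (\<phi> x) (\<phi> y) = u_tilde br x y"
proof -
  obtain \<epsilon> c m k where \<epsilon>: "\<epsilon> = 1 \<or> \<epsilon> = - 1" and c: "c \<in> A"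
    and \<phi>: "\<And>a l. (a, l) \<in> M \<Longrightarrow> \<phi> (a, l) = (\<epsilon> *\<^sub>R a + c, \<epsilon> *\<^sub>R l + cosh_op br a m + sinh_op br a k)"
    using assms(2) unfolding affine_form_def by fast
  \<comment> \<open>At the origin sinh(0) k vanishes and cosh(0) m is m.\<close>
  have "c = 0" "m = 0"
    using \<phi>[OF assms(3)] assms(4) by auto
  obtain a l a' l' where "x = (a, l)" "y = (a', l')"
    by fastforce
  moreover from this have "a \<in> A" "a' \<in> A"
    using assms(1,5,6) by auto
  ultimately show ?thesis
    using assms(5,6) \<epsilon> \<open>c = 0\<close> \<open>m = 0\<close> sinh_op_commute[of a a' k]
    by (auto simp: \<phi> u_tilde_def sinh_op_sign sinh_op_minus_left cosh_op_linear_simps sinh_op_linear_simps)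
qed

end


section \<open>Elementary solvable spaces\<close>

locale elementary_solvable = commuting_bracket br A
  for br :: "'g::euclidean_space \<Rightarrow> 'g \<Rightarrow> 'g" and A :: "'g set" +
  fixes \<sigma> :: "'g \<Rightarrow> 'g" and \<omega> :: "'g \<times> 'g \<Rightarrow> 'g \<times> 'g \<Rightarrow> 'g \<times> 'g \<Rightarrow> real"
    and B :: "'g set" and M :: "('g \<times> 'g) set" and s :: "'g \<times> 'g \<Rightarrow> 'g \<times> 'g \<Rightarrow> 'g \<times> 'g"
  assumes space: "symplectic_symmetric_space M \<omega> s"
    and M_eq: "M = A \<times> eigL \<sigma> B"
    and s_eq: "(a, l) \<in> M \<Longrightarrow> (a', l') \<in> M \<Longrightarrow> s (a, l) (a', l') = (2 *\<^sub>R a - a', 2 *\<^sub>R cosh_op br (a - a') l - l')"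
    and linear_\<sigma>: "linear \<sigma>"
    and \<sigma>_br: "\<sigma> (br x y) = br (\<sigma> x) (\<sigma> y)"
    and \<sigma>_A: "a \<in> A \<Longrightarrow> \<sigma> a = - a"
begin

abbreviation "L \<equiv> eigL \<sigma> B"

lemma fst_M: "x \<in> M \<Longrightarrow> fst x \<in> A"
  by (auto simp: M_eq)

lemma zero_M: "(0, 0) \<in> M"
  using space subspace_0[of M] by (simp add: symplectic_symmetric_space_def zero_prod_def)

lemma s_closed: "x \<in> M \<Longrightarrow> y \<in> M \<Longrightarrow> s x y \<in> M"
  using space unfolding symplectic_symmetric_space_def symplectic_diffeo_def by (meson bij_betwE)

lemma \<sigma>_exp_br: "a \<in> A \<Longrightarrow> \<sigma> (exp_end (br a) x) = exp_end (br (- a)) (\<sigma> x)"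
  using exp_end_intertwine[OF linear_br linear_br linear_\<sigma>, of a "- a" x] \<sigma>_br[of a] \<sigma>_A[of a] by simp

text \<open>The involution exchanges E(a) and E(-a), hence anticommutes with sinh(a); the sign of l
  under it compensates.\<close>

lemma sinh_op_eigP_eigK:
  assumes "a \<in> A" "l \<in> eigP \<sigma>"
  shows "sinh_op br a l \<in> eigK \<sigma>"
  using assms \<sigma>_exp_br[of a l] \<sigma>_exp_br[of "- a" l]
  by (simp add: eigK_def eigP_def sinh_op_eq linear_scale[OF linear_\<sigma>] linear_diff[OF linear_\<sigma>]
      linear_neg[OF linear_exp_br])

lemma u_tilde_eigK: "x \<in> M \<Longrightarrow> y \<in> M \<Longrightarrow> u_tilde br x y \<in> eigK \<sigma>"
  using sinh_op_eigP_eigK[of "fst y" "snd x"] sinh_op_eigP_eigK[of "fst x" "snd y"]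
  by (cases x; cases y) (simp add: M_eq eigL_def u_tilde_def eigK_def linear_diff[OF linear_\<sigma>])

lemma u_tilde_s:
  assumes "x \<in> M" "y \<in> M"
  shows "u_tilde br x (s x y) = - u_tilde br x y"
proof -
  obtain a l c m where xy: "x = (a, l)" "y = (c, m)"
    by (metis surj_pair)
  show ?thesis
    using assms fst_M[OF assms(1)] fst_M[OF assms(2)] u_tilde_symmetry[of a c l m] by (simp add: xy s_eq)
qed

text \<open>On the domain of the midpoint map, \<open>x\<close> is written \<open>(2 h, cosh h n)\<close> and \<open>x/2 = (h, n/2)\<close>.\<close>

lemma half_domainE:
  assumes "x \<in> half_domain br A L"
  obtains h n where "h \<in> A" "x = (h + h, cosh_op br h n)"
    "\<And>c l. (c, l) \<in> M \<Longrightarrow> s (half br L x) (c, l) = (h + h - c, cosh_op br (h - c) n - l)"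
proof -
  obtain a l where x: "x = (a, l)" and a: "a \<in> A" and l: "l \<in> L"
    and bij: "bij_betw (cosh_op br ((1/2) *\<^sub>R a)) L L"
    using assms by (auto simp: half_domain_def)
  define h where "h = (1/2) *\<^sub>R a"
  define n where "n = inv_into L (cosh_op br h) l"
  have h: "h \<in> A" "a = h + h"
    using a by (simp_all add: h_def flip: scaleR_add_left)
  have n: "n \<in> L" "cosh_op br h n = l"
    unfolding n_def h_def using bij l by (auto simp: bij_betw_inv_into_right intro: bij_betwE[OF bij_betw_inv_into, rule_format])
  have half: "half br L x = (h, (1/2) *\<^sub>R n)"
    by (simp add: half_def x n_def h_def)
  \<comment> \<open>That n/2 lies in L is read off from the slice of \<open>M\<close> over a = 0,
    since \<open>M\<close> is a subspace.\<close>
  have "subspace M"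
    using space by (simp add: symplectic_symmetric_space_def)
  moreover have "(0, n) \<in> M"
    using n(1) by (simp add: M_eq)
  ultimately have "(1/2) *\<^sub>R (0, n) \<in> M"
    by (rule subspace_scale)
  then have "(h, (1/2) *\<^sub>R n) \<in> M"
    using h(1) by (simp add: M_eq)
  then have *: "s (half br L x) (c, l) = (h + h - c, cosh_op br (h - c) n - l)" if "(c, l) \<in> M" for c l
    using that by (simp add: half s_eq scaleR_2 cosh_op_linear_simps flip: scaleR_add_left)
  show ?thesis
    by (rule that[OF h(1) _ *]) (simp_all add: x n(2) flip: h(2))
qed

lemma u_tilde_s_half:
  assumes "x \<in> half_domain br A L" "y \<in> M"
  shows "u_tilde br x (s (half br L x) y) = - u_tilde br x y"
  using assms(1)
proof (rule half_domainE)
  fix h n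
  assume *: "h \<in> A" "x = (h + h, cosh_op br h n)"
    "\<And>c l. (c, l) \<in> M \<Longrightarrow> s (half br L x) (c, l) = (h + h - c, cosh_op br (h - c) n - l)"
  obtain c m where y: "y = (c, m)"
    by fastforce
  then show ?thesis
    using *(3)[of c m] *(2) u_tilde_half_symmetry[of h c n m] \<open>h \<in> A\<close> assms(2) fst_M[of y] by simp
qed

lemma u_tilde_s_half_s_half:
  assumes "x \<in> half_domain br A L" "y \<in> M" "z \<in> M"
  shows "u_tilde br (s (half br L x) y) (s (half br L x) z) = sinh_cyclic br x y z"
  using assms(1)
proof (rule half_domainE)
  fix h n
  assume *: "h \<in> A" "x = (h + h, cosh_op br h n)"
    "\<And>c l. (c, l) \<in> M \<Longrightarrow> s (half br L x) (c, l) = (h + h - c, cosh_op br (h - c) n - l)"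
  obtain c m d l where y: "y = (c, m)" and z: "z = (d, l)"
    by fastforce
  then show ?thesis
    using *(3)[of c m] *(3)[of d l] *(2) u_tilde_half_half[of h c d n m l] \<open>h \<in> A\<close> assms(2,3)
      fst_M[of y] fst_M[of z]
    by simp
qed

text \<open>The change is the commutator of sinh(a) and sinh(a') applied to
  \<open>\<kappa>\<close>.\<close>

lemma u_tilde_exp_action:
  assumes "x \<in> M" "y \<in> M"
  shows "u_tilde br (exp_action br \<kappa> x) (exp_action br \<kappa> y) = u_tilde br x y"
  using assms sinh_op_commute[of "fst x" "fst y" \<kappa>] fst_M[of x] fst_M[of y]
  by (cases x; cases y) (simp add: exp_action_def u_tilde_def sinh_op_linear_simps)

section \<open>Invariance under the stabilizer of the origin\<close>

lemma affine_form_s: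
  assumes "x \<in> M"
  shows "affine_form M (s x)"
proof -
  obtain a l where x: "x = (a, l)"
    by fastforce
  have a: "a \<in> A"
    using assms fst_M x by fastforce
  \<comment> \<open>Expanding 2 cosh(a - c) l by the addition theorem separates the variable c from
    the fixed point x.\<close>
  have "s x (c, m) = (- 1 *\<^sub>R c + 2 *\<^sub>R a, - 1 *\<^sub>R m + cosh_op br c (2 *\<^sub>R cosh_op br a l)
      + sinh_op br c (- 2 *\<^sub>R sinh_op br a l))" if "(c, m) \<in> M" for c m
  proof -
    have c: "- c \<in> A"
      using fst_M[OF that] by auto
    have "cosh_op br (a - c) l = cosh_op br c (cosh_op br a l) - sinh_op br c (sinh_op br a l)"
      using cosh_op_add[OF c a, of l] by (simp add: cosh_op_minus_left sinh_op_minus_left)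
    then show ?thesis
      using s_eq[of a l c m] assms that
      by (simp add: x cosh_op_linear_simps sinh_op_linear_simps scaleR_right_diff_distrib)
  qed
  then show ?thesis
    using a by (intro affine_formI[of "- 1" "2 *\<^sub>R a"]) auto
qed

text \<open>Bijectivity is carried through the induction because products need images inside
  \<open>M\<close> and \<open>inv_into M\<close> is a genuine inverse only for bijections of
  \<open>M\<close>.\<close>

lemma symmetry_group_affine_form:
  assumes "\<phi> \<in> symmetry_group M s"
  shows "bij_betw \<phi> M M \<and> affine_form M \<phi>"
  using assms unfolding symmetry_group_def
proof (induction rule: generated_group.induct)
  case ident
  have "affine_form M id"
    by (rule affine_formI[of 1 0 M id 0 0]) (simp_all add: cosh_op_linear_simps sinh_op_linear_simps)
  then show ?case
    using bij_betw_id by blast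
next
  case (base f)
  then show ?case
    using affine_form_s space by (auto simp: symplectic_symmetric_space_def symplectic_diffeo_def)
next
  case (comp f g)
  moreover have "M \<subseteq> A \<times> UNIV"
    by (auto simp: M_eq)
  ultimately show ?case
    using affine_form_comp[of M g f] bij_betw_trans[of g M M f M] bij_betw_imp_surj_on[of g M M] by (simp add: o_def)
next
  case (inverse f)
  moreover have "M \<subseteq> A \<times> UNIV"
    by (auto simp: M_eq)
  ultimately show ?case
    using affine_form_inverse[of M f] bij_betw_inv_into[of f M M] by simp
next
  case (same f g)
  then have "bij_betw g M M"
    using bij_betw_cong by blast
  moreover have "affine_form M g"
    using affine_form_cong same by blast
  ultimately show ?case
    by blast
qed

lemma u_tilde_stabilizer_invariant:
  assumes "\<phi> \<in> stabilizer (symmetry_group M s) (0, 0)" "x \<in> M" "y \<in> M"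
  shows "u_tilde br (\<phi> x) (\<phi> y) = u_tilde br x y"
proof (rule u_tilde_affine_form_invariant[of M])
  show "affine_form M \<phi>" "\<phi> (0, 0) = (0, 0)"
    using assms symmetry_group_affine_form by (auto simp: stabilizer_def)
qed (use assms zero_M in \<open>auto simp: M_eq\<close>)

lemma sinh_cyclic_s_invariant:
  assumes "x \<in> M" "y \<in> M" "z \<in> M" "w \<in> M"
  shows "sinh_cyclic br (s w x) (s w y) (s w z) = sinh_cyclic br x y z"
proof -
  obtain a l where w: "w = (a, l)" by fastforce
  obtain c\<^sub>1 m\<^sub>1 c\<^sub>2 m\<^sub>2 c\<^sub>3 m\<^sub>3 where xyz: "x = (c\<^sub>1, m\<^sub>1)" "y = (c\<^sub>2, m\<^sub>2)" "z = (c\<^sub>3, m\<^sub>3)"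
    by (metis surj_pair)
  show ?thesis
    using assms fst_M[OF assms(1)] fst_M[OF assms(2)] fst_M[OF assms(3)] fst_M[OF assms(4)]
      sinh_cyclic_invariant[of a c\<^sub>1 c\<^sub>2 c\<^sub>3 l m\<^sub>1 m\<^sub>2 m\<^sub>3]
    by (simp add: w xyz s_eq)
qed

lemma sinh_cyclic_s:
  assumes "x \<in> M" "y \<in> M" "z \<in> M"
  shows "sinh_cyclic br x (s x y) z = - sinh_cyclic br x y z"
proof -
  obtain a l c m d n where xyz: "x = (a, l)" "y = (c, m)" "z = (d, n)"
    by (metis surj_pair)
  show ?thesis
    using assms fst_M[OF assms(1)] fst_M[OF assms(2)] fst_M[OF assms(3)] sinh_cyclic_symmetry[of a c d l m n]
    by (simp add: xyz s_eq)
qed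

section \<open>Smoothness and admissibility\<close>

lemma smooth_u_tilde:
  fixes \<xi> :: "'g \<Rightarrow> real"
  assumes "linear \<xi>"
  shows "smooth_map_on (M \<times> M) (\<lambda>(x, y). \<xi> (u_tilde br x y))"
proof (rule smooth_map_on_cong)
  \<comment> \<open>The minus sign is moved into the linear second argument, so that sums of terms
    covered by \<open>smooth_map_on_sinh_op\<close> suffice.\<close>
  show "smooth_map_on (M \<times> M) (\<lambda>p. \<xi> (sinh_op br (fst (snd p)) (snd (fst p)))
      + \<xi> (sinh_op br (fst (fst p)) (- snd (snd p))))"
    by (intro smooth_map_on_add smooth_map_on_sinh_op[where \<xi> = \<xi>] assms bounded_linear.linear
        bounded_linear_intros bounded_linear_minus) (simp_all add: M_eq mem_Times_iff)
qed (auto simp: u_tilde_def sinh_op_linear_simps linear_diff[OF assms] linear_neg[OF assms])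

lemma smooth_sinh_cyclic:
  fixes \<xi> :: "'g \<Rightarrow> real"
  assumes "linear \<xi>"
  shows "smooth_map_on (M \<times> M \<times> M) (\<lambda>(x, y, z). \<xi> (sinh_cyclic br x y z))"
proof (rule smooth_map_on_cong)
  show "smooth_map_on (M \<times> M \<times> M) (\<lambda>p.
      \<xi> (sinh_op br (fst (fst p) - fst (fst (snd p))) (snd (snd (snd p))))
      + \<xi> (sinh_op br (fst (fst (snd p)) - fst (snd (snd p))) (snd (fst p)))
      + \<xi> (sinh_op br (fst (snd (snd p)) - fst (fst p)) (snd (fst (snd p)))))"
    by (intro smooth_map_on_add smooth_map_on_sinh_op[where \<xi> = \<xi>] assms bounded_linear.linear
        bounded_linear_intros) (simp_all add: M_eq mem_Times_iff)
qed (auto simp: sinh_cyclic_def linear_add[OF assms])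

text \<open>Invariance is a premise so that one proof serves two groups: for the group generated by
  the symmetries it is a theorem, for the full automorphism group it remains a condition on
  \<open>\<xi>\<close>.\<close>

lemma o_admissible_u_tilde:
  fixes \<xi> :: "'g \<Rightarrow> real"
  assumes "linear \<xi>" "half_domain br A L = M"
    and "\<And>\<phi> x y. \<phi> \<in> stabilizer H (0, 0) \<Longrightarrow> x \<in> M \<Longrightarrow> y \<in> M \<Longrightarrow>
      \<xi> (u_tilde br (\<phi> x) (\<phi> y)) = \<xi> (u_tilde br x y)"
  shows "o_admissible H M s (0, 0) (half br L) (\<lambda>x y. \<xi> (u_tilde br x y))"
proof -
  have "\<xi> (u_tilde br x y) = - \<xi> (u_tilde br y x)" for x y
    by (simp add: u_tilde_swap[of br x y] linear_neg[OF assms(1)])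
  moreover have "\<xi> (u_tilde br x y) = - \<xi> (u_tilde br x (s x y))"
    "\<xi> (u_tilde br x y) = - \<xi> (u_tilde br x (s (half br L x) y))" if "x \<in> M" "y \<in> M" for x y
    using that assms(2) by (simp_all add: u_tilde_s u_tilde_s_half linear_neg[OF assms(1)])
  ultimately show ?thesis
    unfolding o_admissible_def by (intro conjI ballI smooth_u_tilde[OF assms(1)] assms(3))
qed

lemma three_point_u_tilde:
  assumes "half_domain br A L = M" "x \<in> M" "y \<in> M" "z \<in> M"
  shows "three_point s (half br L) (\<lambda>x y. \<xi> (u_tilde br x y)) x y z = \<xi> (sinh_cyclic br x y z)"
  using u_tilde_s_half_s_half[of x y z] assms by (simp add: three_point_def)

lemma admissible3_u_tilde:
  fixes \<xi> :: "'g \<Rightarrow> real"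
  assumes "linear \<xi>" "half_domain br A L = M"
  shows "admissible3 M s (three_point s (half br L) (\<lambda>x y. \<xi> (u_tilde br x y)))"
proof -
  let ?S = "three_point s (half br L) (\<lambda>x y. \<xi> (u_tilde br x y))"
  \<comment> \<open>On \<open>M\<close> the function equals its closed form, in which the midpoint
    map no longer occurs.\<close>
  have "smooth_map_on (M \<times> M \<times> M) (\<lambda>(x, y, z). ?S x y z)"
    by (rule smooth_map_on_cong[OF smooth_sinh_cyclic[OF assms(1)]])
      (auto simp: three_point_u_tilde[OF assms(2)])
  moreover have "?S x y z = ?S z x y" if "x \<in> M" "y \<in> M" "z \<in> M" for x y z
    using that sinh_cyclic_rotate[of br x y z] by (simp add: three_point_u_tilde[OF assms(2)])
  moreover have "?S x y z = - ?S y x z" if "x \<in> M" "y \<in> M" "z \<in> M" for x y z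
    using that by (simp add: three_point_u_tilde[OF assms(2)] sinh_cyclic_swap[of y x z] linear_neg[OF assms(1)])
  moreover have "?S (s w x) (s w y) (s w z) = ?S x y z" if "x \<in> M" "y \<in> M" "z \<in> M" "w \<in> M" for x y z w
    using that by (simp add: three_point_u_tilde[OF assms(2)] s_closed sinh_cyclic_s_invariant)
  moreover have "?S x y z = - ?S x (s x y) z" if "x \<in> M" "y \<in> M" "z \<in> M" for x y z
    using that
    by (simp add: three_point_u_tilde[OF assms(2)] s_closed sinh_cyclic_s linear_neg[OF assms(1)])
  ultimately show ?thesis
    unfolding admissible3_def by (intro conjI ballI)
qed

end

section \<open>The locale assumptions derived from the exact triple\<close>

lemma lie_algebra_anticommute:
  assumes "lie_algebra br"
  shows "br y x = - br x y"
proof -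
  have bil: "bilinear br" and alt: "br z z = 0" for z
    using assms by (simp_all add: lie_algebra_def)
  show ?thesis
    using alt[of "x + y"] alt[of x] alt[of y]
    by (simp add: bilinear_ladd[OF bil] bilinear_radd[OF bil] add_eq_0_iff)
qed

text \<open>By the Jacobi identity the commutator of \<open>br a\<close> and \<open>br c\<close> is
  \<open>br (br a c)\<close>, on the whole algebra and not only on \<open>B\<close>.\<close>

lemma lie_algebra_commute:
  assumes lie: "lie_algebra br" and "br a c = 0"
  shows "br a (br c x) = br c (br a x)"
proof -
  have bil: "bilinear br" and jacobi: "br a (br c x) + br c (br x a) + br x (br a c) = 0"
    using lie by (simp_all add: lie_algebra_def)
  then show ?thesis
    using assms(2) lie_algebra_anticommute[OF lie, of x a]
    by (simp add: bilinear_rneg[OF bil] bilinear_rzero[OF bil])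
qed

text \<open>
  The bracket of two elements of \<open>P\<close> lies in \<open>B\<close>, so \<open>[P, P] = K\<close> forces \<open>K \<subseteq> B\<close>; hence \<open>\<sigma>\<close>, which
  preserves \<open>A\<close>, is \<open>-1\<close> on it.
\<close>

lemma semidirect_abelian_minus:
  assumes lie: "lie_algebra br" and lin: "linear \<sigma>" and inv: "\<And>x. \<sigma> (\<sigma> x) = x"
    and K: "span {br x y |x y. x \<in> eigP \<sigma> \<and> y \<in> eigP \<sigma>} = eigK \<sigma>"
    and semi: "semidirect_abelian br \<sigma> A B" and "a \<in> A"
  shows "\<sigma> a = - a"
proof -
  have A: "subspace A" and B: "subspace B" and AB: "A \<inter> B = {0}" "\<And>x. \<exists>a\<in>A. \<exists>b\<in>B. x = a + b"
    and br: "\<And>a a'. a \<in> A \<Longrightarrow> a' \<in> A \<Longrightarrow> br a a' = 0" "\<And>b b'. b \<in> B \<Longrightarrow> b' \<in> B \<Longrightarrow> br b b' = 0"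
      "\<And>a b. a \<in> A \<Longrightarrow> b \<in> B \<Longrightarrow> br a b \<in> B" and \<sigma>: "\<sigma> a \<in> A"
    using semi \<open>a \<in> A\<close> by (simp_all add: semidirect_abelian_def image_subset_iff)
  have bil: "bilinear br"
    using lie by (simp add: lie_algebra_def)
  have "br x y \<in> B" for x y
  proof -
    obtain a b a' b' where "x = a + b" "y = a' + b'" and mem: "a \<in> A" "b \<in> B" "a' \<in> A" "b' \<in> B"
      using AB(2) by meson
    then have "br x y = br a b' - br a' b"
      using br(1)[of a a'] br(2)[of b b'] lie_algebra_anticommute[OF lie, of b a'] by (simp add: bilinear_ladd[OF bil] bilinear_radd[OF bil])
    then show ?thesis
      using mem br(3) subspace_diff[OF B] by simp
  qed
  then have "eigK \<sigma> \<subseteq> B"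
    unfolding K[symmetric] by (intro span_minimal B) auto
  moreover have "a + \<sigma> a \<in> eigK \<sigma>"
    by (simp add: eigK_def linear_add[OF lin] inv add.commute)
  moreover have "a + \<sigma> a \<in> A"
    using \<sigma> \<open>a \<in> A\<close> subspace_add[OF A] by blast
  ultimately have "a + \<sigma> a = 0"
    using AB(1) by blast
  then show ?thesis
    by (simp add: add_eq_0_iff)
qed

lemma elementary_solvable_space_imp_elementary_solvable:
  assumes "elementary_solvable_space brh \<sigma>h \<Omega>h br \<sigma> \<Omega> A B M \<omega> s"
  shows "elementary_solvable br A \<sigma> \<omega> B M s"
proof -
  have triple: "exact_triple br \<sigma> \<Omega>" and semi: "semidirect_abelian br \<sigma> A B"
    using assms unfolding elementary_solvable_space_def by blast+
  have lie: "lie_algebra br"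
    using triple unfolding exact_triple_def by blast
  show ?thesis
  proof (intro elementary_solvable.intro elementary_solvable_axioms.intro commuting_bracket.intro)
    show "bilinear br"
      using lie by (simp add: lie_algebra_def)
    show "subspace A"
      using semi by (simp add: semidirect_abelian_def)
    show "br a (br c x) = br c (br a x)" if "a \<in> A" "c \<in> A" for a c x
      using lie_algebra_commute[OF lie] semi that by (simp add: semidirect_abelian_def)
    show "symplectic_symmetric_space M \<omega> s" "M = A \<times> eigL \<sigma> B"
      using assms unfolding elementary_solvable_space_def by blast+
    show "s (a, l) (a', l') = (2 *\<^sub>R a - a', 2 *\<^sub>R cosh_op br (a - a') l - l')"
      if "(a, l) \<in> M" "(a', l') \<in> M" for a l a' l'
      using assms that unfolding elementary_solvable_space_def by blast
    show "linear \<sigma>"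
      using triple unfolding exact_triple_def by blast
    show "\<sigma> (br x y) = br (\<sigma> x) (\<sigma> y)" for x y
      using triple unfolding exact_triple_def by blast
    show "\<sigma> a = - a" if "a \<in> A" for a
      using triple unfolding exact_triple_def by (intro semidirect_abelian_minus[OF lie _ _ _ semi that]) blast+
  qed
qed

theorem proposition4p9:
  fixes brh :: "'h::euclidean_space \<Rightarrow> 'h \<Rightarrow> 'h"
    and \<sigma>h :: "'h \<Rightarrow> 'h"
    and \<Omega>h :: "'h \<Rightarrow> 'h \<Rightarrow> real"
    and br :: "'g::euclidean_space \<Rightarrow> 'g \<Rightarrow> 'g"
    and \<sigma> :: "'g \<Rightarrow> 'g"
    and \<Omega> :: "'g \<Rightarrow> 'g \<Rightarrow> real"
    and A B :: "'g set"
    and M :: "('g \<times> 'g) set"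
    and \<omega> :: "'g \<times> 'g \<Rightarrow> 'g \<times> 'g \<Rightarrow> 'g \<times> 'g \<Rightarrow> real"
    and s :: "'g \<times> 'g \<Rightarrow> 'g \<times> 'g \<Rightarrow> 'g \<times> 'g"
  assumes "elementary_solvable_space brh \<sigma>h \<Omega>h br \<sigma> \<Omega> A B M \<omega> s"
  shows
    "(\<forall>x\<in>M. \<forall>y\<in>M. u_tilde br x y \<in> eigK \<sigma>) \<and>
     (\<forall>x\<in>M. \<forall>y\<in>M.
        u_tilde br x y = - u_tilde br y x \<and>
        u_tilde br x y = - u_tilde br x (s x y) \<and>
        (x \<in> half_domain br A (eigL \<sigma> B) \<longrightarrow>
           u_tilde br x y = - u_tilde br x (s (half br (eigL \<sigma> B) x) y))) \<and>
     (\<forall>\<kappa>\<in>eigK \<sigma>. \<forall>x\<in>M. \<forall>y\<in>M.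
        u_tilde br (exp_action br \<kappa> x) (exp_action br \<kappa> y) = u_tilde br x y) \<and>
     (half_domain br A (eigL \<sigma> B) = M \<and> midpoint_map M s (0, 0) (half br (eigL \<sigma> B)) \<longrightarrow>
        (\<forall>\<xi> :: 'g \<Rightarrow> real. linear \<xi> \<longrightarrow>
           (let u = (\<lambda>x y. \<xi> (u_tilde br x y));
                S = three_point s (half br (eigL \<sigma> B)) u
            in o_admissible (symmetry_group M s) M s (0, 0) (half br (eigL \<sigma> B)) u \<and>
               ((\<forall>\<phi>\<in>stabilizer (automorphism_group M \<omega> s) (0, 0). \<forall>x\<in>M. \<forall>y\<in>M.
                   u (\<phi> x) (\<phi> y) = u x y) \<longrightarrow>
                 o_admissible (automorphism_group M \<omega> s) M s (0, 0) (half br (eigL \<sigma> B)) u) \<and>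
               admissible3 M s S \<and>
               (\<forall>a1 l1 a2 l2 a3 l3. (a1, l1) \<in> M \<longrightarrow> (a2, l2) \<in> M \<longrightarrow> (a3, l3) \<in> M \<longrightarrow>
                  S (a1, l1) (a2, l2) (a3, l3) =
                    \<xi> (sinh_op br (a1 - a2) l3 + sinh_op br (a2 - a3) l1 + sinh_op br (a3 - a1) l2)))))"
proof -
  interpret elementary_solvable br A \<sigma> \<omega> B M s
    using assms by (rule elementary_solvable_space_imp_elementary_solvable)
  have identities: "\<forall>x\<in>M. \<forall>y\<in>M.
      u_tilde br x y = - u_tilde br y x \<and>
      u_tilde br x y = - u_tilde br x (s x y) \<and>
      (x \<in> half_domain br A L \<longrightarrow> u_tilde br x y = - u_tilde br x (s (half br L x) y))"
    by (auto simp: u_tilde_s u_tilde_s_half intro: u_tilde_swap)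
  have admissibility: "let u = (\<lambda>x y. \<xi> (u_tilde br x y)); S = three_point s (half br L) u
    in o_admissible (symmetry_group M s) M s (0, 0) (half br L) u \<and>
       ((\<forall>\<phi>\<in>stabilizer (automorphism_group M \<omega> s) (0, 0). \<forall>x\<in>M. \<forall>y\<in>M. u (\<phi> x) (\<phi> y) = u x y) \<longrightarrow>
         o_admissible (automorphism_group M \<omega> s) M s (0, 0) (half br L) u) \<and>
       admissible3 M s S \<and>
       (\<forall>a1 l1 a2 l2 a3 l3. (a1, l1) \<in> M \<longrightarrow> (a2, l2) \<in> M \<longrightarrow> (a3, l3) \<in> M \<longrightarrow>
          S (a1, l1) (a2, l2) (a3, l3) =
            \<xi> (sinh_op br (a1 - a2) l3 + sinh_op br (a2 - a3) l1 + sinh_op br (a3 - a1) l2))"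
    if dom: "half_domain br A L = M" and \<xi>: "linear \<xi>" for \<xi> :: "'g \<Rightarrow> real"
    unfolding Let_def
  proof (intro conjI impI allI)
    show "o_admissible (symmetry_group M s) M s (0, 0) (half br L) (\<lambda>x y. \<xi> (u_tilde br x y))"
      using u_tilde_stabilizer_invariant by (intro o_admissible_u_tilde[OF \<xi> dom]) simp
    show "o_admissible (automorphism_group M \<omega> s) M s (0, 0) (half br L) (\<lambda>x y. \<xi> (u_tilde br x y))"
      if "\<forall>\<phi>\<in>stabilizer (automorphism_group M \<omega> s) (0, 0). \<forall>x\<in>M. \<forall>y\<in>M.
        \<xi> (u_tilde br (\<phi> x) (\<phi> y)) = \<xi> (u_tilde br x y)"
      using that by (intro o_admissible_u_tilde[OF \<xi> dom]) blast
    show "admissible3 M s (three_point s (half br L) (\<lambda>x y. \<xi> (u_tilde br x y)))"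
      by (rule admissible3_u_tilde[OF \<xi> dom])
    show "three_point s (half br L) (\<lambda>x y. \<xi> (u_tilde br x y)) (a1, l1) (a2, l2) (a3, l3) =
        \<xi> (sinh_op br (a1 - a2) l3 + sinh_op br (a2 - a3) l1 + sinh_op br (a3 - a1) l2)"
      if "(a1, l1) \<in> M" "(a2, l2) \<in> M" "(a3, l3) \<in> M" for a1 l1 a2 l2 a3 l3
      using three_point_u_tilde[OF dom that] by (simp add: sinh_cyclic_def)
  qed
  have eigK: "\<forall>x\<in>M. \<forall>y\<in>M. u_tilde br x y \<in> eigK \<sigma>"
    and exp_action: "\<forall>\<kappa>\<in>eigK \<sigma>. \<forall>x\<in>M. \<forall>y\<in>M.
      u_tilde br (exp_action br \<kappa> x) (exp_action br \<kappa> y) = u_tilde br x y"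
    using u_tilde_eigK u_tilde_exp_action by simp_all
  show ?thesis
    by (intro conjI eigK identities exp_action impI allI admissibility) blast+
qed

end
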